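(* Let $(\mathfrak g,[\cdot,\cdot])$ be a Lie algebra over a field $\mathbb K$ of characteristic zero, let $\pi_+\in\operatorname{End}(\mathfrak g)$ satisfy $$[\pi_+(x),\pi_+(y)]+\pi_+([x,y])=\pi_+([\pi_+(x),y]+[x,\pi_+(y)])\qquad(x,y\in\mathfrak g),$$ put $\pi_-:=\operatorname{id}-\pi_+$, let $x\triangleright y:=-[\pi_+(x),y]$ be the associated post-Lie product, and let $\bar{\mathfrak g}$ be the associated double Lie algebra. Let $F:\mathcal U(\bar{\mathfrak g})\to\mathcal U(\mathfrak g)$ be the linear map $$F:=\mu\circ(\operatorname{id}\otimes S)\circ(\mathrm r_-\otimes\mathrm r_+)\circ\Delta .$$ Then $F$ is an algebra morphism from $\mathcal U(\bar{\mathfrak g})$ to $\mathcal U_*(\mathfrak g)=(\mathcal U(\mathfrak g),* )$, i.e., it is a linear map such that $$F(x_1\cdots x_n)=F(x_1)*\cdots*F(x_n)$$ for all monomials $x_1\cdots x_n\in\mathcal U(\bar{\mathfrak g})$ (with $x_i\in\bar{\mathfrak g}$).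
   Context: $\mathcal U(\mathfrak g)$ is the universal enveloping algebra of $(\mathfrak g,[\cdot,\cdot])$ with its usual product $\mu$ (also written by juxtaposition), unit $\mathbf 1$, counit $\epsilon$, antipode $S$ (the antimorphism with $S(x)=-x$ for $x\in\mathfrak g$), and coproduct $\Delta$, the algebra morphism with $\Delta(x)=x\otimes\mathbf 1+\mathbf 1\otimes x$ for $x\in\mathfrak g$; Sweedler notation $\Delta(A)=A_{(1)}\otimes A_{(2)}$ is used. The product $\triangleright$ on $\mathfrak g$ extends uniquely to a bilinear product on $\mathcal U(\mathfrak g)$ with $\mathbf 1\triangleright A=A$, $A\triangleright\mathbf 1=\epsilon(A)\mathbf 1$, $A\triangleright(BC)=(A_{(1)}\triangleright B)(A_{(2)}\triangleright C)$, and $(xA)\triangleright B=x\triangleright(A\triangleright B)-(x\triangleright A)\triangleright B$ for $x\in\mathfrak g$, $A,B,C\in\mathcal U(\mathfrak g)$. In particular $x\triangleright$ acts as a derivation for $x\in\mathfrak g$. The product $A*B:=A_{(1)}(A_{(2)}\triangleright B)$ on $\mathcal U(\mathfrak g)$ is associative with unit $\mathbf 1$; $\mathcal U_*(\mathfrak g)$ denotes $\mathcal U(\mathfrak g)$ with the product $*$. The double Lie algebra $\bar{\mathfrak g}$ is the vector space $\mathfrak g$ with the Lie bracket $[[x,y]]:=[\pi_-(x),y]+[x,\pi_-(y)]-[x,y]=x\triangleright y-y\triangleright x+[x,y]$. $\mathcal U(\bar{\mathfrak g})$ is its universal enveloping algebra; its product is written as concatenation of monomials $x_1\cdots x_n$,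 and its standard coproduct, for which elements of $\bar{\mathfrak g}$ are primitive, is the $\Delta$ occurring in the definition of $F$. The linear maps $\mathrm r_+:=-\pi_+$ and $\mathrm r_-:=\pi_-$ are Lie algebra morphisms $\bar{\mathfrak g}\to\mathfrak g$, and the same symbols denote the induced unital algebra morphisms $\mathcal U(\bar{\mathfrak g})\to\mathcal U(\mathfrak g)$. *)

theory Defs
  imports Complex_Main "HOL-Algebra.QuotRing" "HOL-Algebra.Module" "HOL-Library.Poly_Mapping"
begin

section \<open>Lie algebras\<close>

locale lie_algebra = vector_space scale
  for scale :: "'k::field \<Rightarrow> 'g::ab_group_add \<Rightarrow> 'g" +
  fixes bracket :: "'g \<Rightarrow> 'g \<Rightarrow> 'g"
  assumes bracket_linear_left: "Vector_Spaces.linear scale scale (\<lambda>x. bracket x y)"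
    and bracket_linear_right: "Vector_Spaces.linear scale scale (bracket x)"
    and bracket_self: "bracket x x = 0"
    and jacobi: "bracket x (bracket y z) + bracket y (bracket z x) + bracket z (bracket x y) = 0"

definition post_lie_product :: "('g \<Rightarrow> 'g \<Rightarrow> 'g) \<Rightarrow> ('g \<Rightarrow> 'g) \<Rightarrow> 'g \<Rightarrow> 'g \<Rightarrow> 'g::ab_group_add"
  where "post_lie_product bracket \<pi> x y = - bracket (\<pi> x) y"

definition compl_proj :: "('g \<Rightarrow> 'g) \<Rightarrow> 'g \<Rightarrow> 'g::ab_group_add"
  where "compl_proj \<pi> x = x - \<pi> x"

definition double_bracket :: "('g \<Rightarrow> 'g \<Rightarrow> 'g) \<Rightarrow> ('g \<Rightarrow> 'g) \<Rightarrow> 'g \<Rightarrow> 'g \<Rightarrow> 'g::ab_group_add"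
  where "double_bracket bracket \<pi> x y =
    bracket (compl_proj \<pi> x) y + bracket x (compl_proj \<pi> y) - bracket x y"

definition r_plus :: "('g \<Rightarrow> 'g) \<Rightarrow> 'g \<Rightarrow> 'g::ab_group_add"
  where "r_plus \<pi> x = - \<pi> x"

definition r_minus :: "('g \<Rightarrow> 'g) \<Rightarrow> 'g \<Rightarrow> 'g::ab_group_add"
  where "r_minus \<pi> = compl_proj \<pi>"

section \<open>Algebras presented by generators and relations\<close>

text \<open>
  Associative unital algebras over a field, given by the type class of \<open>'k\<close>, are represented by
  records of type \<open>('k, 'a) module\<close>, which contain a ring structure and a scalar multiplication.
  (The library locale of the name algebra is for commutative algebras only.)
\<close>

definition monoid_algebra :: "('m, 'z) monoid_scheme \<Rightarrow> ('k::field, 'm \<Rightarrow>\<^sub>0 'k) module"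
  where "monoid_algebra M =
    \<lparr>carrier = {p. Poly_Mapping.keys p \<subseteq> carrier M},
     mult = (\<lambda>p q. \<Sum>m\<in>Poly_Mapping.keys p. \<Sum>n\<in>Poly_Mapping.keys q.
       Poly_Mapping.single (m \<otimes>\<^bsub>M\<^esub> n) (Poly_Mapping.lookup p m * Poly_Mapping.lookup q n)),
     one = Poly_Mapping.single \<one>\<^bsub>M\<^esub> 1,
     zero = 0,
     add = (+),
     smult = (\<lambda>c. Poly_Mapping.map ((*) c))\<rparr>"

text \<open>The two-sided ideal generated by \<open>R\<close> is closed under scalars because \<open>A\<close> is unital.\<close>

definition quot_algebra :: "('k, 'a) module \<Rightarrow> 'a set \<Rightarrow> ('k, 'a set) module"
  where "quot_algebra A R = (let I = Idl\<^bsub>A\<^esub> R; Q = A Quot I in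
    \<lparr>carrier = carrier Q, mult = mult Q, one = one Q, zero = zero Q, add = add Q,
     smult = (\<lambda>c X. \<Union>a\<in>X. I +>\<^bsub>A\<^esub> (c \<odot>\<^bsub>A\<^esub> a))\<rparr>)"

definition quot_class :: "('k, 'a) module \<Rightarrow> 'a set \<Rightarrow> 'a \<Rightarrow> 'a set"
  where "quot_class A R a = (Idl\<^bsub>A\<^esub> R) +>\<^bsub>A\<^esub> a"

definition lin_extend :: "('k::field, 'b) module \<Rightarrow> ('m \<Rightarrow> 'b) \<Rightarrow> ('m \<Rightarrow>\<^sub>0 'k) \<Rightarrow> 'b"
  where "lin_extend B \<phi> p =
    (\<Oplus>\<^bsub>B\<^esub>m\<in>Poly_Mapping.keys p. Poly_Mapping.lookup p m \<odot>\<^bsub>B\<^esub> \<phi> m)"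

text \<open>
  The linear map induced on a quotient of a monoid algebra by a map \<open>\<phi>\<close> on the monoid; it is
  meaningful when the linear extension of \<open>\<phi>\<close> is constant on cosets.
\<close>

definition quot_lift :: "('k::field, 'b) module \<Rightarrow> ('m \<Rightarrow> 'b) \<Rightarrow> ('m \<Rightarrow>\<^sub>0 'k) set \<Rightarrow> 'b"
  where "quot_lift B \<phi> X = the_elem (lin_extend B \<phi> ` X)"

definition opp_algebra :: "('k, 'a) module \<Rightarrow> ('k, 'a) module"
  where "opp_algebra A = A\<lparr>mult := \<lambda>a b. b \<otimes>\<^bsub>A\<^esub> a\<rparr>"

definition scalar_algebra :: "('k::field, 'k) module"
  where "scalar_algebra =
    \<lparr>carrier = UNIV, mult = (*), one = 1, zero = 0, add = (+), smult = (*)\<rparr>"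

definition algebra_hom :: "('k, 'a) module \<Rightarrow> ('k, 'b) module \<Rightarrow> ('a \<Rightarrow> 'b) set"
  where "algebra_hom A B =
    {h \<in> ring_hom A B. \<forall>c. \<forall>a\<in>carrier A. h (c \<odot>\<^bsub>A\<^esub> a) = c \<odot>\<^bsub>B\<^esub> h a}"

definition list_prod :: "('a, 'z) monoid_scheme \<Rightarrow> 'a list \<Rightarrow> 'a"
  where "list_prod A as = foldr (mult A) as \<one>\<^bsub>A\<^esub>"

definition bilinear_map ::
    "('k, 'a) module \<Rightarrow> ('k, 'b) module \<Rightarrow> ('k, 'c) module \<Rightarrow> ('a \<Rightarrow> 'b \<Rightarrow> 'c) \<Rightarrow> bool"
  where "bilinear_map A B C \<beta> \<longleftrightarrow>
    (\<forall>a\<in>carrier A. \<forall>b\<in>carrier B. \<beta> a b \<in> carrier C) \<and>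
    (\<forall>a\<in>carrier A. \<forall>a'\<in>carrier A. \<forall>b\<in>carrier B. \<beta> (a \<oplus>\<^bsub>A\<^esub> a') b = \<beta> a b \<oplus>\<^bsub>C\<^esub> \<beta> a' b) \<and>
    (\<forall>a\<in>carrier A. \<forall>b\<in>carrier B. \<forall>b'\<in>carrier B. \<beta> a (b \<oplus>\<^bsub>B\<^esub> b') = \<beta> a b \<oplus>\<^bsub>C\<^esub> \<beta> a b') \<and>
    (\<forall>c. \<forall>a\<in>carrier A. \<forall>b\<in>carrier B. \<beta> (c \<odot>\<^bsub>A\<^esub> a) b = c \<odot>\<^bsub>C\<^esub> \<beta> a b) \<and>
    (\<forall>c. \<forall>a\<in>carrier A. \<forall>b\<in>carrier B. \<beta> a (c \<odot>\<^bsub>B\<^esub> b) = c \<odot>\<^bsub>C\<^esub> \<beta> a b)"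

section \<open>Tensor products\<close>

definition tensor_relations ::
    "('k::field, 'a) module \<Rightarrow> ('k, 'b) module \<Rightarrow> ('a \<times> 'b \<Rightarrow>\<^sub>0 'k) set"
  where "tensor_relations A B =
    {Poly_Mapping.single (a \<oplus>\<^bsub>A\<^esub> a', b) 1 - Poly_Mapping.single (a, b) 1 - Poly_Mapping.single (a', b) 1
      | a a' b. a \<in> carrier A \<and> a' \<in> carrier A \<and> b \<in> carrier B} \<union>
    {Poly_Mapping.single (a, b \<oplus>\<^bsub>B\<^esub> b') 1 - Poly_Mapping.single (a, b) 1 - Poly_Mapping.single (a, b') 1
      | a b b'. a \<in> carrier A \<and> b \<in> carrier B \<and> b' \<in> carrier B} \<union>
    {Poly_Mapping.single (c \<odot>\<^bsub>A\<^esub> a, b) 1 - Poly_Mapping.single (a, b) c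
      | c a b. a \<in> carrier A \<and> b \<in> carrier B} \<union>
    {Poly_Mapping.single (a, c \<odot>\<^bsub>B\<^esub> b) 1 - Poly_Mapping.single (a, b) c
      | c a b. a \<in> carrier A \<and> b \<in> carrier B}"

text \<open>
  As an additive group, the monoid algebra of \<open>A \<times>\<times> B\<close> is the free vector space on pairs. Products
  of a pair with a relation are again relations, so the ideal generated by the relations is just
  their linear span, and the quotient is the usual tensor product of algebras, with
  \<open>(a \<otimes> b) (a' \<otimes> b') = a a' \<otimes> b b'\<close>.
\<close>

definition tensor_algebra ::
    "('k::field, 'a) module \<Rightarrow> ('k, 'b) module \<Rightarrow> ('k, ('a \<times> 'b \<Rightarrow>\<^sub>0 'k) set) module"
  where "tensor_algebra A B = quot_algebra (monoid_algebra (A \<times>\<times> B)) (tensor_relations A B)"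

definition pure_tensor ::
    "('k::field, 'a) module \<Rightarrow> ('k, 'b) module \<Rightarrow> 'a \<Rightarrow> 'b \<Rightarrow> ('a \<times> 'b \<Rightarrow>\<^sub>0 'k) set"
  where "pure_tensor A B a b =
    quot_class (monoid_algebra (A \<times>\<times> B)) (tensor_relations A B) (Poly_Mapping.single (a, b) 1)"

text \<open>
  The linear map on a tensor product induced by a bilinear map \<open>\<beta>\<close> into \<open>C\<close>; in Sweedler notation,
  \<open>tensor_lift C \<beta> (\<Delta> a)\<close> is \<open>\<beta>\<close> applied to \<open>a\<^sub>(\<^sub>1\<^sub>)\<close> and \<open>a\<^sub>(\<^sub>2\<^sub>)\<close>.
\<close>

definition tensor_lift ::
    "('k::field, 'c) module \<Rightarrow> ('a \<Rightarrow> 'b \<Rightarrow> 'c) \<Rightarrow> ('a \<times> 'b \<Rightarrow>\<^sub>0 'k) set \<Rightarrow> 'c"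
  where "tensor_lift C \<beta> = quot_lift C (\<lambda>(a, b). \<beta> a b)"

text \<open>The map \<open>f \<otimes> g\<close> with values in the tensor product of \<open>A\<close> and \<open>B\<close>.\<close>

definition tensor_map ::
    "('k::field, 'a) module \<Rightarrow> ('k, 'b) module \<Rightarrow> ('c \<Rightarrow> 'a) \<Rightarrow> ('d \<Rightarrow> 'b) \<Rightarrow>
      ('c \<times> 'd \<Rightarrow>\<^sub>0 'k) set \<Rightarrow> ('a \<times> 'b \<Rightarrow>\<^sub>0 'k) set"
  where "tensor_map A B f g = tensor_lift (tensor_algebra A B) (\<lambda>c d. pure_tensor A B (f c) (g d))"

section \<open>Universal enveloping algebras\<close>

text \<open>The monoid algebra of \<open>word_monoid\<close> is the free algebra on the underlying set of \<open>'g\<close>.\<close>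

definition word_monoid :: "'g list monoid"
  where "word_monoid = \<lparr>carrier = UNIV, mult = (@), one = []\<rparr>"

text \<open>
  The first two families of relations make the words linear in their letters, that is, turn the
  free algebra on the set \<open>'g\<close> into the tensor algebra of the vector space \<open>'g\<close>.
\<close>

definition uea_relations ::
    "('k::field \<Rightarrow> 'g::ab_group_add \<Rightarrow> 'g) \<Rightarrow> ('g \<Rightarrow> 'g \<Rightarrow> 'g) \<Rightarrow> ('g list \<Rightarrow>\<^sub>0 'k) set"
  where "uea_relations scale bracket =
    {Poly_Mapping.single [x + y] 1 - Poly_Mapping.single [x] 1 - Poly_Mapping.single [y] 1 | x y. True} \<union>
    {Poly_Mapping.single [scale c x] 1 - Poly_Mapping.single [x] c | c x. True} \<union>
    {Poly_Mapping.single [x, y] 1 - Poly_Mapping.single [y, x] 1 - Poly_Mapping.single [bracket x y] 1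
      | x y. True}"

definition uea ::
    "('k::field \<Rightarrow> 'g::ab_group_add \<Rightarrow> 'g) \<Rightarrow> ('g \<Rightarrow> 'g \<Rightarrow> 'g) \<Rightarrow> ('k, ('g list \<Rightarrow>\<^sub>0 'k) set) module"
  where "uea scale bracket = quot_algebra (monoid_algebra word_monoid) (uea_relations scale bracket)"

definition uea_gen ::
    "('k::field \<Rightarrow> 'g::ab_group_add \<Rightarrow> 'g) \<Rightarrow> ('g \<Rightarrow> 'g \<Rightarrow> 'g) \<Rightarrow> 'g \<Rightarrow> ('g list \<Rightarrow>\<^sub>0 'k) set"
  where "uea_gen scale bracket x =
    quot_class (monoid_algebra word_monoid) (uea_relations scale bracket) (Poly_Mapping.single [x] 1)"

text \<open>
  The unital algebra morphism from an enveloping algebra into \<open>B\<close> with prescribed values \<open>f x\<close> at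
  the generators, where \<open>f\<close> is linear and turns brackets into commutators in \<open>B\<close>.
\<close>

definition uea_lift :: "('k::field, 'b) module \<Rightarrow> ('g \<Rightarrow> 'b) \<Rightarrow> ('g list \<Rightarrow>\<^sub>0 'k) set \<Rightarrow> 'b"
  where "uea_lift B f = quot_lift B (\<lambda>w. list_prod B (map f w))"

definition uea_coproduct ::
    "('k::field \<Rightarrow> 'g::ab_group_add \<Rightarrow> 'g) \<Rightarrow> ('g \<Rightarrow> 'g \<Rightarrow> 'g) \<Rightarrow>
      ('g list \<Rightarrow>\<^sub>0 'k) set \<Rightarrow> (('g list \<Rightarrow>\<^sub>0 'k) set \<times> ('g list \<Rightarrow>\<^sub>0 'k) set \<Rightarrow>\<^sub>0 'k) set"
  where "uea_coproduct scale bracket =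
    (let U = uea scale bracket; \<iota> = uea_gen scale bracket; T = tensor_algebra U U in
      uea_lift T (\<lambda>x. pure_tensor U U (\<iota> x) \<one>\<^bsub>U\<^esub> \<oplus>\<^bsub>T\<^esub> pure_tensor U U \<one>\<^bsub>U\<^esub> (\<iota> x)))"

definition uea_counit :: "('g list \<Rightarrow>\<^sub>0 'k::field) set \<Rightarrow> 'k"
  where "uea_counit = uea_lift scalar_algebra (\<lambda>x. 0)"

definition uea_antipode ::
    "('k::field \<Rightarrow> 'g::ab_group_add \<Rightarrow> 'g) \<Rightarrow> ('g \<Rightarrow> 'g \<Rightarrow> 'g) \<Rightarrow>
      ('g list \<Rightarrow>\<^sub>0 'k) set \<Rightarrow> ('g list \<Rightarrow>\<^sub>0 'k) set"
  where "uea_antipode scale bracket =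
    uea_lift (opp_algebra (uea scale bracket)) (\<lambda>x. uea_gen scale bracket (- x))"

text \<open>
  The algebra morphism, into the enveloping algebra for \<open>bracket\<close>, induced by a Lie algebra
  morphism \<open>f\<close>.
\<close>

definition uea_map ::
    "('k::field \<Rightarrow> 'g::ab_group_add \<Rightarrow> 'g) \<Rightarrow> ('g \<Rightarrow> 'g \<Rightarrow> 'g) \<Rightarrow> ('h \<Rightarrow> 'g) \<Rightarrow>
      ('h list \<Rightarrow>\<^sub>0 'k) set \<Rightarrow> ('g list \<Rightarrow>\<^sub>0 'k) set"
  where "uea_map scale bracket f = uea_lift (uea scale bracket) (\<lambda>x. uea_gen scale bracket (f x))"

section \<open>The extended post-Lie product\<close>

text \<open>
  \<open>tri\<close> is the extension, unique on the carrier, of the post-Lie product \<open>tr\<close> to the enveloping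
  algebra.
\<close>

definition post_lie_extension ::
    "('k::field \<Rightarrow> 'g::ab_group_add \<Rightarrow> 'g) \<Rightarrow> ('g \<Rightarrow> 'g \<Rightarrow> 'g) \<Rightarrow> ('g \<Rightarrow> 'g \<Rightarrow> 'g) \<Rightarrow>
      (('g list \<Rightarrow>\<^sub>0 'k) set \<Rightarrow> ('g list \<Rightarrow>\<^sub>0 'k) set \<Rightarrow> ('g list \<Rightarrow>\<^sub>0 'k) set) \<Rightarrow> bool"
  where "post_lie_extension scale bracket tr tri \<longleftrightarrow>
    (let U = uea scale bracket; \<iota> = uea_gen scale bracket; \<Delta> = uea_coproduct scale bracket in
      bilinear_map U U U tri \<and>
      (\<forall>x y. tri (\<iota> x) (\<iota> y) = \<iota> (tr x y)) \<and>
      (\<forall>A\<in>carrier U. tri \<one>\<^bsub>U\<^esub> A = A) \<and>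
      (\<forall>A\<in>carrier U. tri A \<one>\<^bsub>U\<^esub> = uea_counit A \<odot>\<^bsub>U\<^esub> \<one>\<^bsub>U\<^esub>) \<and>
      (\<forall>A\<in>carrier U. \<forall>B\<in>carrier U. \<forall>C\<in>carrier U.
        tri A (B \<otimes>\<^bsub>U\<^esub> C) = tensor_lift U (\<lambda>A1 A2. tri A1 B \<otimes>\<^bsub>U\<^esub> tri A2 C) (\<Delta> A)) \<and>
      (\<forall>x. \<forall>A\<in>carrier U. \<forall>B\<in>carrier U.
        tri (\<iota> x \<otimes>\<^bsub>U\<^esub> A) B = tri (\<iota> x) (tri A B) \<ominus>\<^bsub>U\<^esub> tri (tri (\<iota> x) A) B))"

definition star_product ::
    "('k::field \<Rightarrow> 'g::ab_group_add \<Rightarrow> 'g) \<Rightarrow> ('g \<Rightarrow> 'g \<Rightarrow> 'g) \<Rightarrow>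
      (('g list \<Rightarrow>\<^sub>0 'k) set \<Rightarrow> ('g list \<Rightarrow>\<^sub>0 'k) set \<Rightarrow> ('g list \<Rightarrow>\<^sub>0 'k) set) \<Rightarrow>
      ('g list \<Rightarrow>\<^sub>0 'k) set \<Rightarrow> ('g list \<Rightarrow>\<^sub>0 'k) set \<Rightarrow> ('g list \<Rightarrow>\<^sub>0 'k) set"
  where "star_product scale bracket tri A B =
    (let U = uea scale bracket in
      tensor_lift U (\<lambda>A1 A2. A1 \<otimes>\<^bsub>U\<^esub> tri A2 B) (uea_coproduct scale bracket A))"

definition uea_star ::
    "('k::field \<Rightarrow> 'g::ab_group_add \<Rightarrow> 'g) \<Rightarrow> ('g \<Rightarrow> 'g \<Rightarrow> 'g) \<Rightarrow>
      (('g list \<Rightarrow>\<^sub>0 'k) set \<Rightarrow> ('g list \<Rightarrow>\<^sub>0 'k) set \<Rightarrow> ('g list \<Rightarrow>\<^sub>0 'k) set) \<Rightarrow>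
      ('k, ('g list \<Rightarrow>\<^sub>0 'k) set) module"
  where "uea_star scale bracket tri =
    (uea scale bracket)\<lparr>mult := star_product scale bracket tri\<rparr>"

section \<open>The map \<open>F\<close>\<close>

definition F_map ::
    "('k::field \<Rightarrow> 'g::ab_group_add \<Rightarrow> 'g) \<Rightarrow> ('g \<Rightarrow> 'g \<Rightarrow> 'g) \<Rightarrow> ('g \<Rightarrow> 'g) \<Rightarrow>
      ('g list \<Rightarrow>\<^sub>0 'k) set \<Rightarrow> ('g list \<Rightarrow>\<^sub>0 'k) set"
  where "F_map scale bracket \<pi> =
    (let U = uea scale bracket in
      tensor_lift U (mult U)
      \<circ> tensor_map U U id (uea_antipode scale bracket)
      \<circ> tensor_map U U (uea_map scale bracket (r_minus \<pi>)) (uea_map scale bracket (r_plus \<pi>))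
      \<circ> uea_coproduct scale (double_bracket bracket \<pi>))"

end

theory Submission
  imports Defs
begin

text \<open>
  Write \<open>P\<close> for the given endomorphism \<open>\<pi>\<close> and identify \<open>x\<close> with its image \<open>\<iota> x\<close> in the
  enveloping algebra \<open>U\<close>. Two observations about a single generator \<open>x\<close> make the theorem true.

  First, \<open>x \<triangleright> _\<close> is a derivation of \<open>U\<close> with \<open>x \<triangleright> y = - [P x, y]\<close> on generators, so it is
  minus the commutator with \<open>P x\<close>, and therefore
  \<open>x * Y = x Y + x \<triangleright> Y = (x - P x) Y + Y (P x)\<close> for every \<open>Y\<close> (lemma \<open>star_gen\<close>). Second, \<open>x\<close> is
  primitive, \<open>r_-\<close> is multiplicative, and \<open>S \<circ> r_+\<close> reverses products and sends \<open>x\<close> to \<open>P x\<close>, so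
  \<open>F (x X) = (x - P x) (F X) + (F X) (P x)\<close>. Together, \<open>F (x X) = x * F X\<close> (lemma \<open>F_gen_mult\<close>).

  Induction on the number of factors of \<open>X\<close> then gives \<open>F (X Y) = F X * F Y\<close> (lemma \<open>F_mult\<close>). The
  step \<open>F (x X Y) = x * (F X * F Y) = (x * F X) * F Y\<close> needs associativity of \<open>*\<close> only when the
  left factor is a generator (lemma \<open>star_assoc_gen\<close>); it follows from the formula for \<open>x * Y\<close> and
  the rule \<open>(x * X) \<triangleright> Y = x \<triangleright> (X \<triangleright> Y)\<close>.

  The rest of the work is to justify these manipulations for the concrete coset models of \<open>U\<close>, of
  the tensor square of \<open>U\<close> and of the maps out of them. Both models are quotients of a monoid algebra
  by an ideal given by generators, and both universal properties come from one criterion for a linear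
  extension to vanish on such an ideal (lemma \<open>lin_extend_genideal\<close>).
\<close>

section \<open>Linear spaces and linear maps\<close>

locale linear_space = abelian_group V
  for V :: "('k::field, 'v) module" (structure) +
  assumes smult_closed [simp, intro]: "v \<in> carrier V \<Longrightarrow> c \<odot> v \<in> carrier V"
    and smult_l_distr: "v \<in> carrier V \<Longrightarrow> (c + d) \<odot> v = c \<odot> v \<oplus> d \<odot> v"
    and smult_r_distr: "v \<in> carrier V \<Longrightarrow> w \<in> carrier V \<Longrightarrow> c \<odot> (v \<oplus> w) = c \<odot> v \<oplus> c \<odot> w"
    and smult_smult: "v \<in> carrier V \<Longrightarrow> c \<odot> (d \<odot> v) = (c * d) \<odot> v"
    and smult_one [simp]: "v \<in> carrier V \<Longrightarrow> 1 \<odot> v = v"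
begin

lemma smult_0_left [simp]: "v \<in> carrier V \<Longrightarrow> 0 \<odot> v = \<zero>"
  using smult_l_distr[of v 0 0] by (metis add.r_cancel_one' add_0 smult_closed)

lemma smult_0_right [simp]: "c \<odot> \<zero> = \<zero>"
  using smult_r_distr[of \<zero> \<zero> c] by (metis add.r_cancel_one' r_zero smult_closed zero_closed)

lemma smult_minus_left: "v \<in> carrier V \<Longrightarrow> (- c) \<odot> v = \<ominus> (c \<odot> v)"
  using smult_l_distr[of v "- c" c] by (simp add: minus_equality)

end

locale unital_algebra = ring A + linear_space A
  for A :: "('k::field, 'a) module" (structure) +
  assumes smult_mult_left: "a \<in> carrier A \<Longrightarrow> b \<in> carrier A \<Longrightarrow> (c \<odot> a) \<otimes> b = c \<odot> (a \<otimes> b)"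
    and smult_mult_right: "a \<in> carrier A \<Longrightarrow> b \<in> carrier A \<Longrightarrow> a \<otimes> (c \<odot> b) = c \<odot> (a \<otimes> b)"

definition linear_maps :: "('k, 'a) module \<Rightarrow> ('k, 'b) module \<Rightarrow> ('a \<Rightarrow> 'b) set"
  where "linear_maps A B = {h \<in> carrier A \<rightarrow> carrier B.
    (\<forall>a\<in>carrier A. \<forall>b\<in>carrier A. h (a \<oplus>\<^bsub>A\<^esub> b) = h a \<oplus>\<^bsub>B\<^esub> h b) \<and>
    (\<forall>c. \<forall>a\<in>carrier A. h (c \<odot>\<^bsub>A\<^esub> a) = c \<odot>\<^bsub>B\<^esub> h a)}"

lemma linear_mapsI:
  assumes "\<And>a. a \<in> carrier A \<Longrightarrow> h a \<in> carrier B"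
    and "\<And>a b. a \<in> carrier A \<Longrightarrow> b \<in> carrier A \<Longrightarrow> h (a \<oplus>\<^bsub>A\<^esub> b) = h a \<oplus>\<^bsub>B\<^esub> h b"
    and "\<And>c a. a \<in> carrier A \<Longrightarrow> h (c \<odot>\<^bsub>A\<^esub> a) = c \<odot>\<^bsub>B\<^esub> h a"
  shows "h \<in> linear_maps A B"
  using assms by (auto simp: linear_maps_def)

lemma linear_mapsD:
  assumes "h \<in> linear_maps A B"
  shows "a \<in> carrier A \<Longrightarrow> h a \<in> carrier B"
    and "a \<in> carrier A \<Longrightarrow> b \<in> carrier A \<Longrightarrow> h (a \<oplus>\<^bsub>A\<^esub> b) = h a \<oplus>\<^bsub>B\<^esub> h b"
    and "a \<in> carrier A \<Longrightarrow> h (c \<odot>\<^bsub>A\<^esub> a) = c \<odot>\<^bsub>B\<^esub> h a"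
  using assms by (auto simp: linear_maps_def)

lemma linear_maps_comp:
  "g \<in> linear_maps B C \<Longrightarrow> f \<in> linear_maps A B \<Longrightarrow> (\<lambda>a. g (f a)) \<in> linear_maps A C"
  by (auto simp: linear_maps_def Pi_iff)

lemma bilinear_mapD:
  assumes "bilinear_map A B C \<beta>"
  shows "b \<in> carrier B \<Longrightarrow> (\<lambda>a. \<beta> a b) \<in> linear_maps A C"
    and "a \<in> carrier A \<Longrightarrow> \<beta> a \<in> linear_maps B C"
  using assms by (auto simp: bilinear_map_def intro!: linear_mapsI)

lemma bilinear_map_comp:
  assumes "bilinear_map A B C \<beta>" "f \<in> linear_maps A' A" "g \<in> linear_maps B' B"
  shows "bilinear_map A' B' C (\<lambda>a b. \<beta> (f a) (g b))"
  using assms by (auto simp: bilinear_map_def linear_maps_def Pi_iff)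

lemma bilinear_map_comp_left:
  assumes "bilinear_map A B C \<beta>" "h \<in> linear_maps C C'"
  shows "bilinear_map A B C' (\<lambda>a b. h (\<beta> a b))"
  using assms by (auto simp: bilinear_map_def linear_maps_def Pi_iff)

lemma linear_maps_id: "(\<lambda>a. a) \<in> linear_maps A A"
  by (rule linear_mapsI) auto

lemma (in unital_algebra) bilinear_map_mult: "bilinear_map A A A (\<otimes>)"
  by (auto simp: bilinear_map_def l_distr r_distr smult_mult_left smult_mult_right)

lemma (in linear_space) bilinear_map_add:
  assumes "bilinear_map A B V \<beta>" "bilinear_map A B V \<gamma>"
  shows "bilinear_map A B V (\<lambda>a b. \<beta> a b \<oplus> \<gamma> a b)"
  using assms by (simp add: bilinear_map_def smult_r_distr a_ac)

lemma (in linear_space) linear_maps_add: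
  assumes "f \<in> linear_maps A V" "g \<in> linear_maps A V"
  shows "(\<lambda>a. f a \<oplus> g a) \<in> linear_maps A V"
  using linear_mapsD[OF assms(1)] linear_mapsD[OF assms(2)]
  by (intro linear_mapsI) (simp_all add: smult_r_distr a_ac)

section \<open>Linear combinations and linear extensions\<close>

text \<open>
  An identity whose two sides are linear in \<open>p\<close> needs to be verified only for multiples of basis
  elements. The set \<open>S\<close> keeps track of the carrier that contains the keys.
\<close>

lemma poly_mapping_induct_singles [consumes 1, case_names zero single add]:
  fixes p :: "'m \<Rightarrow>\<^sub>0 'k::field"
  assumes "Poly_Mapping.keys p \<subseteq> S"
    and "P 0"
    and "\<And>m c. m \<in> S \<Longrightarrow> P (Poly_Mapping.single m c)"
    and "\<And>p q. Poly_Mapping.keys p \<subseteq> S \<Longrightarrow> Poly_Mapping.keys q \<subseteq> S \<Longrightarrow> P p \<Longrightarrow> P q \<Longrightarrow> P (p + q)"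
  shows "P p"
proof -
  let ?f = "\<lambda>m. Poly_Mapping.single m (Poly_Mapping.lookup p m)"
  have "Poly_Mapping.keys (sum ?f T) \<subseteq> S \<and> P (sum ?f T)" if "finite T" "T \<subseteq> S" for T
    using that
  proof (induction T rule: finite_induct)
    case (insert m T)
    have "Poly_Mapping.keys (?f m) \<subseteq> S" using insert.prems by simp
    with insert show ?case
      using assms(3,4) keys_add[of "?f m" "sum ?f T"] by auto
  qed (use assms(2) in auto)
  moreover have "p = sum ?f (Poly_Mapping.keys p)"
    by (rule poly_mapping_eqI) (simp add: lookup_sum lookup_single when_def in_keys_iff)
  ultimately show ?thesis using assms(1) by (metis finite_keys)
qed

lemma keys_add_subset: "Poly_Mapping.keys p \<subseteq> S \<Longrightarrow> Poly_Mapping.keys q \<subseteq> S \<Longrightarrow> Poly_Mapping.keys (p + q) \<subseteq> S"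
  using keys_add[of p q] by blast

lemma keys_diff_subset:
  assumes "Poly_Mapping.keys p \<subseteq> S" "Poly_Mapping.keys q \<subseteq> S"
  shows "Poly_Mapping.keys (p - q :: 'm \<Rightarrow>\<^sub>0 'k::field) \<subseteq> S"
proof
  fix m assume "m \<in> Poly_Mapping.keys (p - q)"
  then have "Poly_Mapping.lookup p m \<noteq> 0 \<or> Poly_Mapping.lookup q m \<noteq> 0"
    by (auto simp: in_keys_iff lookup_minus)
  then show "m \<in> S" using assms by (auto simp: in_keys_iff)
qed

lemma lookup_map_times:
  "Poly_Mapping.lookup (Poly_Mapping.map ((*) c) p) m = c * Poly_Mapping.lookup (p :: 'm \<Rightarrow>\<^sub>0 'k::field) m"
  by (simp add: Poly_Mapping.map.rep_eq when_def)

lemma keys_map_times: "Poly_Mapping.keys (Poly_Mapping.map ((*) c) p) \<subseteq> Poly_Mapping.keys (p :: 'm \<Rightarrow>\<^sub>0 'k::field)"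
  by (auto simp: in_keys_iff lookup_map_times)

lemma map_times_add: "Poly_Mapping.map ((*) (c::'k::field)) (p + q) = Poly_Mapping.map ((*) c) p + Poly_Mapping.map ((*) c) q"
  by (rule poly_mapping_eqI) (simp add: lookup_map_times lookup_add distrib_left)

context linear_space
begin

text \<open>
  The sums for \<open>p\<close>, \<open>q\<close> and \<open>p + q\<close> run over different sets of keys, as terms may cancel; terms
  outside the keys vanish, so that all three can be taken over a common finite set.
\<close>

lemma lin_extend_superset:
  assumes "finite S" "Poly_Mapping.keys p \<subseteq> S" "\<phi> \<in> S \<rightarrow> carrier V"
  shows "lin_extend V \<phi> p = (\<Oplus>m\<in>S. Poly_Mapping.lookup p m \<odot> \<phi> m)"
  unfolding lin_extend_def
  by (rule add.finprod_mono_neutral_cong_left) (use assms in \<open>auto simp: in_keys_iff Pi_iff\<close>)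

lemma lin_extend_zero: "lin_extend V \<phi> 0 = \<zero>"
  by (simp add: lin_extend_def)

lemma lin_extend_closed:
  assumes "Poly_Mapping.keys p \<subseteq> S" "\<phi> \<in> S \<rightarrow> carrier V"
  shows "lin_extend V \<phi> p \<in> carrier V"
  unfolding lin_extend_def by (rule finsum_closed) (use assms in auto)

lemma lin_extend_single: "\<phi> m \<in> carrier V \<Longrightarrow> lin_extend V \<phi> (Poly_Mapping.single m c) = c \<odot> \<phi> m"
  using lin_extend_superset[of "{m}" "Poly_Mapping.single m c" \<phi>] by simp

lemma lin_extend_add:
  assumes "Poly_Mapping.keys p \<subseteq> S" "Poly_Mapping.keys q \<subseteq> S" "\<phi> \<in> S \<rightarrow> carrier V"
  shows "lin_extend V \<phi> (p + q) = lin_extend V \<phi> p \<oplus> lin_extend V \<phi> q"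
proof -
  let ?T = "Poly_Mapping.keys p \<union> Poly_Mapping.keys q"
  have \<phi>: "\<phi> m \<in> carrier V" if "m \<in> ?T" for m using that assms by auto
  then have T: "\<phi> \<in> ?T \<rightarrow> carrier V" by blast
  have "lin_extend V \<phi> (p + q) = (\<Oplus>m\<in>?T. Poly_Mapping.lookup (p + q) m \<odot> \<phi> m)"
    using T keys_add[of p q] by (intro lin_extend_superset) auto
  also have "\<dots> = (\<Oplus>m\<in>?T. Poly_Mapping.lookup p m \<odot> \<phi> m \<oplus> Poly_Mapping.lookup q m \<odot> \<phi> m)"
    by (rule finsum_cong') (simp_all add: \<phi> lookup_add smult_l_distr Pi_iff del: Un_iff)
  also have "\<dots> = (\<Oplus>m\<in>?T. Poly_Mapping.lookup p m \<odot> \<phi> m) \<oplus> (\<Oplus>m\<in>?T. Poly_Mapping.lookup q m \<odot> \<phi> m)"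
    by (rule finsum_addf) (simp_all add: \<phi> Pi_iff del: Un_iff)
  also have "\<dots> = lin_extend V \<phi> p \<oplus> lin_extend V \<phi> q"
    using T by (simp add: lin_extend_superset[of ?T])
  finally show ?thesis .
qed

lemma lin_extend_smult:
  assumes "Poly_Mapping.keys p \<subseteq> S" "\<phi> \<in> S \<rightarrow> carrier V"
  shows "lin_extend V \<phi> (Poly_Mapping.map ((*) c) p) = c \<odot> lin_extend V \<phi> p"
  using assms(1)
proof (induction rule: poly_mapping_induct_singles)
  case (add p q)
  moreover have "Poly_Mapping.keys (Poly_Mapping.map ((*) c) p) \<subseteq> S" "Poly_Mapping.keys (Poly_Mapping.map ((*) c) q) \<subseteq> S"
    using keys_map_times[of c p] keys_map_times[of c q] add.hyps by auto
  ultimately show ?case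
    by (simp add: map_times_add lin_extend_add[OF _ _ assms(2)] smult_r_distr lin_extend_closed[OF _ assms(2)])
qed (use assms(2) in \<open>auto simp: map_eq_zero_iff[THEN iffD2] lin_extend_zero lin_extend_single Pi_iff smult_smult\<close>)

lemma lin_extend_diff:
  assumes "Poly_Mapping.keys p \<subseteq> S" "Poly_Mapping.keys q \<subseteq> S" "\<phi> \<in> S \<rightarrow> carrier V"
  shows "lin_extend V \<phi> (p - q) = lin_extend V \<phi> p \<ominus> lin_extend V \<phi> q"
proof -
  let ?q = "Poly_Mapping.map ((*) (- 1)) q"
  have "Poly_Mapping.keys ?q \<subseteq> S"
    using keys_map_times[of "- 1" q] assms(2) by blast
  then have "lin_extend V \<phi> (p + ?q) = lin_extend V \<phi> p \<ominus> lin_extend V \<phi> q"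
    using assms by (simp add: lin_extend_add[of _ S] lin_extend_smult[of _ S] smult_minus_left
        lin_extend_closed[of _ S] minus_eq)
  moreover have "p + ?q = p - q"
    by (rule poly_mapping_eqI) (simp add: lookup_minus lookup_add lookup_map_times)
  ultimately show ?thesis by simp
qed

end

section \<open>Monoid algebras\<close>

context monoid
begin

lemma monoid_algebra_sel:
  "carrier (monoid_algebra G) = {p. Poly_Mapping.keys p \<subseteq> carrier G}"
  "\<one>\<^bsub>monoid_algebra G\<^esub> = Poly_Mapping.single \<one> 1"
  "\<zero>\<^bsub>monoid_algebra G\<^esub> = 0"
  "p \<oplus>\<^bsub>monoid_algebra G\<^esub> q = p + q"
  "c \<odot>\<^bsub>monoid_algebra G\<^esub> p = Poly_Mapping.map ((*) c) p"
  by (simp_all add: monoid_algebra_def)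

lemma monoid_algebra_mult_superset:
  assumes "finite S" "finite T" "Poly_Mapping.keys p \<subseteq> S" "Poly_Mapping.keys q \<subseteq> T"
  shows "p \<otimes>\<^bsub>monoid_algebra G\<^esub> q = (\<Sum>m\<in>S. \<Sum>n\<in>T.
    Poly_Mapping.single (m \<otimes> n) (Poly_Mapping.lookup p m * Poly_Mapping.lookup q n))"
proof -
  have "p \<otimes>\<^bsub>monoid_algebra G\<^esub> q = (\<Sum>m\<in>Poly_Mapping.keys p. \<Sum>n\<in>T.
    Poly_Mapping.single (m \<otimes> n) (Poly_Mapping.lookup p m * Poly_Mapping.lookup q n))"
    unfolding monoid_algebra_def monoid.simps ring.simps using assms
    by (intro sum.cong sum.mono_neutral_left) (auto simp: in_keys_iff)
  also have "\<dots> = (\<Sum>m\<in>S. \<Sum>n\<in>T.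
    Poly_Mapping.single (m \<otimes> n) (Poly_Mapping.lookup p m * Poly_Mapping.lookup q n))"
    using assms by (intro sum.mono_neutral_left) (auto simp: in_keys_iff)
  finally show ?thesis .
qed

lemma monoid_algebra_mult_single:
  "Poly_Mapping.single m c \<otimes>\<^bsub>monoid_algebra G\<^esub> Poly_Mapping.single n d = Poly_Mapping.single (m \<otimes> n) (c * d)"
  by (simp add: monoid_algebra_mult_superset[of "{m}" "{n}"])

lemma monoid_algebra_mult_zero:
  "0 \<otimes>\<^bsub>monoid_algebra G\<^esub> p = 0" "p \<otimes>\<^bsub>monoid_algebra G\<^esub> 0 = 0"
  by (simp_all add: monoid_algebra_def)

lemma monoid_algebra_mult_add_left:
  "(p + q) \<otimes>\<^bsub>monoid_algebra G\<^esub> r = p \<otimes>\<^bsub>monoid_algebra G\<^esub> r + q \<otimes>\<^bsub>monoid_algebra G\<^esub> r"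
proof -
  let ?S = "Poly_Mapping.keys p \<union> Poly_Mapping.keys q"
  show ?thesis
    using keys_add[of p q]
    by (simp add: monoid_algebra_mult_superset[of ?S "Poly_Mapping.keys r"] lookup_add distrib_right
        single_add sum.distrib)
qed

lemma monoid_algebra_mult_add_right:
  "r \<otimes>\<^bsub>monoid_algebra G\<^esub> (p + q) = r \<otimes>\<^bsub>monoid_algebra G\<^esub> p + r \<otimes>\<^bsub>monoid_algebra G\<^esub> q"
proof -
  let ?S = "Poly_Mapping.keys p \<union> Poly_Mapping.keys q"
  show ?thesis
    using keys_add[of p q]
    by (simp add: monoid_algebra_mult_superset[of "Poly_Mapping.keys r" ?S] lookup_add distrib_left
        single_add sum.distrib)
qed

lemma monoid_algebra_mult_keys:
  assumes "Poly_Mapping.keys p \<subseteq> carrier G" "Poly_Mapping.keys q \<subseteq> carrier G"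
  shows "Poly_Mapping.keys (p \<otimes>\<^bsub>monoid_algebra G\<^esub> q) \<subseteq> carrier G"
  using assms(1)
proof (induction rule: poly_mapping_induct_singles)
  case (single m c)
  show ?case using assms(2)
    by (induction rule: poly_mapping_induct_singles)
      (use single in \<open>simp_all add: monoid_algebra_mult_zero monoid_algebra_mult_single keys_add_subset
        monoid_algebra_mult_add_right\<close>)
qed (simp_all add: monoid_algebra_mult_zero monoid_algebra_mult_add_left keys_add_subset)

lemma monoid_algebra_mult_assoc:
  assumes "Poly_Mapping.keys p \<subseteq> carrier G" "Poly_Mapping.keys q \<subseteq> carrier G" "Poly_Mapping.keys r \<subseteq> carrier G"
  shows "(p \<otimes>\<^bsub>monoid_algebra G\<^esub> q) \<otimes>\<^bsub>monoid_algebra G\<^esub> r = p \<otimes>\<^bsub>monoid_algebra G\<^esub> (q \<otimes>\<^bsub>monoid_algebra G\<^esub> r)"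
  using assms(1)
proof (induction rule: poly_mapping_induct_singles)
  case m: (single m c)
  show ?case using assms(2)
  proof (induction rule: poly_mapping_induct_singles)
    case n: (single n d)
    show ?case using assms(3)
      by (induction rule: poly_mapping_induct_singles)
        (use m n in \<open>simp_all add: monoid_algebra_mult_zero monoid_algebra_mult_single m_assoc mult.assoc
          monoid_algebra_mult_add_right\<close>)
  qed (simp_all add: monoid_algebra_mult_zero monoid_algebra_mult_add_left monoid_algebra_mult_add_right)
qed (simp_all add: monoid_algebra_mult_zero monoid_algebra_mult_add_left)

lemma monoid_algebra_one_mult:
  assumes "Poly_Mapping.keys p \<subseteq> carrier G"
  shows "Poly_Mapping.single \<one> 1 \<otimes>\<^bsub>monoid_algebra G\<^esub> p = p"
    and "p \<otimes>\<^bsub>monoid_algebra G\<^esub> Poly_Mapping.single \<one> 1 = p"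
  using assms
  by (induction rule: poly_mapping_induct_singles)
    (simp_all add: monoid_algebra_mult_zero monoid_algebra_mult_single monoid_algebra_mult_add_left
      monoid_algebra_mult_add_right)

lemma monoid_algebra_smult_mult:
  "Poly_Mapping.map ((*) c) p \<otimes>\<^bsub>monoid_algebra G\<^esub> q = Poly_Mapping.map ((*) c) (p \<otimes>\<^bsub>monoid_algebra G\<^esub> q)"
  "p \<otimes>\<^bsub>monoid_algebra G\<^esub> Poly_Mapping.map ((*) c) q = Poly_Mapping.map ((*) c) (p \<otimes>\<^bsub>monoid_algebra G\<^esub> q)"
proof -
  let ?S = "Poly_Mapping.keys p" and ?T = "Poly_Mapping.keys q"
  have "Poly_Mapping.lookup (Poly_Mapping.map ((*) c) p \<otimes>\<^bsub>monoid_algebra G\<^esub> q) n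
      = Poly_Mapping.lookup (Poly_Mapping.map ((*) c) (p \<otimes>\<^bsub>monoid_algebra G\<^esub> q)) n"
    "Poly_Mapping.lookup (p \<otimes>\<^bsub>monoid_algebra G\<^esub> Poly_Mapping.map ((*) c) q) n
      = Poly_Mapping.lookup (Poly_Mapping.map ((*) c) (p \<otimes>\<^bsub>monoid_algebra G\<^esub> q)) n" for n
    by (simp_all add: monoid_algebra_mult_superset[of ?S ?T] keys_map_times lookup_map_times lookup_sum
        lookup_single when_def sum_distrib_left mult_ac if_distrib cong: if_cong)
  then show "Poly_Mapping.map ((*) c) p \<otimes>\<^bsub>monoid_algebra G\<^esub> q = Poly_Mapping.map ((*) c) (p \<otimes>\<^bsub>monoid_algebra G\<^esub> q)"
    "p \<otimes>\<^bsub>monoid_algebra G\<^esub> Poly_Mapping.map ((*) c) q = Poly_Mapping.map ((*) c) (p \<otimes>\<^bsub>monoid_algebra G\<^esub> q)"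
    by (auto intro: poly_mapping_eqI)
qed

lemma unital_algebra_monoid_algebra:
  "unital_algebra (monoid_algebra G :: ('k::field, 'a \<Rightarrow>\<^sub>0 'k) module)" (is "unital_algebra ?A")
proof -
  have "abelian_group ?A"
  proof (rule abelian_groupI)
    fix p assume "p \<in> carrier ?A"
    then show "\<exists>q\<in>carrier ?A. q \<oplus>\<^bsub>?A\<^esub> p = \<zero>\<^bsub>?A\<^esub>"
      by (intro bexI[of _ "- p"]) (auto simp: monoid_algebra_sel in_keys_iff)
  qed (auto simp: monoid_algebra_sel keys_add_subset add_ac)
  moreover have "ring ?A"
    by (rule ringI, fact, rule monoidI)
      (auto simp: monoid_algebra_sel monoid_algebra_mult_keys monoid_algebra_mult_assoc monoid_algebra_one_mult
        monoid_algebra_mult_add_left monoid_algebra_mult_add_right)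
  moreover have "linear_space_axioms ?A"
    by (rule linear_space_axioms.intro)
      (auto simp: monoid_algebra_sel lookup_map_times lookup_add algebra_simps in_keys_iff subset_iff
        intro!: poly_mapping_eqI)
  moreover have "unital_algebra_axioms ?A"
    by (rule unital_algebra_axioms.intro) (auto simp: monoid_algebra_sel monoid_algebra_smult_mult)
  ultimately show ?thesis
    by (intro unital_algebra.intro linear_space.intro)
qed

end

section \<open>Quotients of algebras\<close>

text \<open>
  The axioms of a unital algebra are identities, apart from the existence of negatives, and a map
  that respects the operations carries both to its image.
\<close>

lemma unital_algebra_image:
  assumes "unital_algebra A" and carr: "carrier B = h ` carrier A"
    and add: "\<And>a b. a \<in> carrier A \<Longrightarrow> b \<in> carrier A \<Longrightarrow> h a \<oplus>\<^bsub>B\<^esub> h b = h (a \<oplus>\<^bsub>A\<^esub> b)"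
    and mult: "\<And>a b. a \<in> carrier A \<Longrightarrow> b \<in> carrier A \<Longrightarrow> h a \<otimes>\<^bsub>B\<^esub> h b = h (a \<otimes>\<^bsub>A\<^esub> b)"
    and smult: "\<And>c a. a \<in> carrier A \<Longrightarrow> c \<odot>\<^bsub>B\<^esub> h a = h (c \<odot>\<^bsub>A\<^esub> a)"
    and one: "\<one>\<^bsub>B\<^esub> = h \<one>\<^bsub>A\<^esub>" and zero: "\<zero>\<^bsub>B\<^esub> = h \<zero>\<^bsub>A\<^esub>"
  shows "unital_algebra B"
proof -
  interpret A: unital_algebra A by fact
  have ag: "abelian_group B"
  proof (rule abelian_groupI)
    fix x assume "x \<in> carrier B"
    then obtain a where "a \<in> carrier A" "x = h a" by (auto simp: carr)
    then show "\<exists>y\<in>carrier B. y \<oplus>\<^bsub>B\<^esub> x = \<zero>\<^bsub>B\<^esub>"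
      by (intro bexI[of _ "h (\<ominus>\<^bsub>A\<^esub> a)"]) (auto simp: carr add zero A.l_neg)
  qed (auto simp: carr add zero A.a_ac)
  moreover have "ring B"
    by (rule ringI, fact, rule monoidI)
      (auto simp: carr add mult one A.m_assoc A.l_distr A.r_distr)
  moreover have "linear_space_axioms B"
    by (rule linear_space_axioms.intro)
      (auto simp: carr add smult A.smult_l_distr A.smult_r_distr A.smult_smult)
  moreover have "unital_algebra_axioms B"
    by (rule unital_algebra_axioms.intro)
      (auto simp: carr mult smult A.smult_mult_left A.smult_mult_right)
  ultimately show ?thesis
    by (intro unital_algebra.intro linear_space.intro)
qed

locale algebra_quotient = unital_algebra A for A :: "('k::field, 'a) module" (structure) +
  fixes R :: "'a set"
  assumes relations_closed: "R \<subseteq> carrier A"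
begin

sublocale ideal "Idl R" A
  using relations_closed by (rule genideal_ideal)

lemma quot_algebra_sel:
  "carrier (quot_algebra A R) = quot_class A R ` carrier A"
  "\<one>\<^bsub>quot_algebra A R\<^esub> = quot_class A R \<one>"
  "\<zero>\<^bsub>quot_algebra A R\<^esub> = quot_class A R \<zero>"
  by (auto simp: quot_algebra_def quot_class_def FactRing_def A_RCOSETS_def' Let_def a_rcos_zero[OF is_ideal]
      additive_subgroup.zero_closed ideal.axioms is_ideal)

lemma quot_class_add:
  "a \<in> carrier A \<Longrightarrow> b \<in> carrier A \<Longrightarrow>
    quot_class A R (a \<oplus> b) = quot_class A R a \<oplus>\<^bsub>quot_algebra A R\<^esub> quot_class A R b"
  by (simp add: quot_algebra_def quot_class_def FactRing_def Let_def a_rcos_sum)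

lemma quot_class_mult:
  "a \<in> carrier A \<Longrightarrow> b \<in> carrier A \<Longrightarrow>
    quot_class A R (a \<otimes> b) = quot_class A R a \<otimes>\<^bsub>quot_algebra A R\<^esub> quot_class A R b"
  by (simp add: quot_algebra_def quot_class_def FactRing_def Let_def rcoset_mult_add)

lemma mem_quot_class: "b \<in> quot_class A R a \<longleftrightarrow> (\<exists>i\<in>Idl R. b = i \<oplus> a)"
  by (auto simp: quot_class_def a_r_coset_def')

lemma quot_class_eqI:
  assumes "a \<in> carrier A" "i \<in> Idl R"
  shows "quot_class A R (i \<oplus> a) = quot_class A R a"
  unfolding quot_class_def
  by (rule a_repr_independence[symmetric, OF _ assms(1) a_subgroup])
    (use assms(2) in \<open>auto simp: a_r_coset_def'\<close>)

lemma quot_class_self: "a \<in> carrier A \<Longrightarrow> a \<in> quot_class A R a"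
  unfolding quot_class_def by (rule a_rcos_self)

text \<open>
  The scalar multiple of a coset does not depend on the representative, because an ideal of a unital
  algebra is stable under scalars: \<open>c \<odot> i = (c \<odot> \<one>) \<otimes> i\<close>.
\<close>

lemma quot_class_smult:
  assumes "a \<in> carrier A"
  shows "quot_class A R (c \<odot> a) = c \<odot>\<^bsub>quot_algebra A R\<^esub> quot_class A R a"
proof -
  have *: "quot_class A R (c \<odot> b) = quot_class A R (c \<odot> a)" if b: "b \<in> quot_class A R a" for b
  proof -
    obtain i where i: "i \<in> Idl R" "b = i \<oplus> a" using b unfolding mem_quot_class by blast
    have ic: "i \<in> carrier A" using i(1) by (rule a_Hcarr)
    have "(c \<odot> \<one>) \<otimes> i \<in> Idl R" using i(1) by (rule I_l_closed) simp
    also have "(c \<odot> \<one>) \<otimes> i = c \<odot> i" using ic by (simp add: smult_mult_left)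
    finally have "quot_class A R (c \<odot> i \<oplus> c \<odot> a) = quot_class A R (c \<odot> a)" 
      using assms by (intro quot_class_eqI) auto
    then show ?thesis unfolding i(2) smult_r_distr[OF ic assms] .
  qed
  have "c \<odot>\<^bsub>quot_algebra A R\<^esub> quot_class A R a = (\<Union>b\<in>quot_class A R a. quot_class A R (c \<odot> b))"
    unfolding quot_algebra_def quot_class_def Let_def by simp
  also have "\<dots> = quot_class A R (c \<odot> a)"
    by (rule UN_constant_eq[OF quot_class_self[OF assms]]) (intro ballI *)
  finally show ?thesis ..
qed

lemma unital_algebra_quot_algebra: "unital_algebra (quot_algebra A R)"
  by (rule unital_algebra_image[OF unital_algebra_axioms])
    (simp_all add: quot_algebra_sel quot_class_add quot_class_mult quot_class_smult)

lemma quot_class_closed: "a \<in> carrier A \<Longrightarrow> quot_class A R a \<in> carrier (quot_algebra A R)"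
  by (simp add: quot_algebra_sel)

end

section \<open>Algebras presented by a monoid and relations\<close>

text \<open>
  With \<open>M\<close> the monoid of words this covers enveloping algebras, and with \<open>M\<close> a product of two algebras
  it covers their tensor product.
\<close>

locale presentation = monoid M for M :: "'m monoid" (structure) +
  fixes R :: "('m \<Rightarrow>\<^sub>0 'k::field) set"
  assumes relations_subset: "R \<subseteq> carrier (monoid_algebra M)"
begin

abbreviation "A \<equiv> monoid_algebra M :: ('k, 'm \<Rightarrow>\<^sub>0 'k) module"
abbreviation "Q \<equiv> quot_algebra A R"

definition cls where "cls m = quot_class A R (Poly_Mapping.single m 1)"

sublocale A: algebra_quotient "monoid_algebra M" R
  by (intro algebra_quotient.intro unital_algebra_monoid_algebra algebra_quotient_axioms.intro
      relations_subset)

sublocale Q: unital_algebra "quot_algebra (monoid_algebra M) R"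
  by (rule A.unital_algebra_quot_algebra)

lemma cls_closed [simp]: "m \<in> carrier M \<Longrightarrow> cls m \<in> carrier Q"
  by (simp add: cls_def A.quot_class_closed monoid_algebra_sel)

lemma cls_mult: "m \<in> carrier M \<Longrightarrow> n \<in> carrier M \<Longrightarrow> cls (m \<otimes> n) = cls m \<otimes>\<^bsub>Q\<^esub> cls n"
  using A.quot_class_mult[of "Poly_Mapping.single m 1" "Poly_Mapping.single n 1"]
  by (simp add: cls_def monoid_algebra_sel monoid_algebra_mult_single)

lemma cls_one: "cls \<one> = \<one>\<^bsub>Q\<^esub>"
  by (simp add: cls_def A.quot_algebra_sel monoid_algebra_sel)

lemma quot_class_single:
  assumes "m \<in> carrier M"
  shows "quot_class A R (Poly_Mapping.single m c) = c \<odot>\<^bsub>Q\<^esub> cls m"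
  using assms A.quot_class_smult[of "Poly_Mapping.single m 1" c]
  by (simp add: cls_def monoid_algebra_sel)

lemma quot_induct [consumes 1, case_names cls add smult]:
  assumes "X \<in> carrier Q"
    and cls: "\<And>m. m \<in> carrier M \<Longrightarrow> P (cls m)"
    and add: "\<And>X Y. X \<in> carrier Q \<Longrightarrow> Y \<in> carrier Q \<Longrightarrow> P X \<Longrightarrow> P Y \<Longrightarrow> P (X \<oplus>\<^bsub>Q\<^esub> Y)"
    and smult: "\<And>c X. X \<in> carrier Q \<Longrightarrow> P X \<Longrightarrow> P (c \<odot>\<^bsub>Q\<^esub> X)"
  shows "P X"
proof -
  have single: "P (quot_class A R (Poly_Mapping.single m c))" if "m \<in> carrier M" for m c
    using that by (simp add: quot_class_single cls smult)
  obtain p where "X = quot_class A R p" "Poly_Mapping.keys p \<subseteq> carrier M"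
    using assms(1) by (auto simp: A.quot_algebra_sel monoid_algebra_sel)
  moreover from this(2) have "P (quot_class A R p)"
  proof (induction rule: poly_mapping_induct_singles)
    case zero
    show ?case using single[of \<one> 0] by simp
  next
    case (add p q)
    then show ?case
      using assms(3)[OF A.quot_class_closed A.quot_class_closed, of p q] A.quot_class_add[of p q]
      by (simp add: monoid_algebra_sel)
  qed (fact single)
  ultimately show ?thesis by simp
qed

text \<open>
  The kernel of a single linear extension need not be an ideal. For a family \<open>\<Phi>\<close> that is stable under
  translations by elements of \<open>M\<close>, however, the common kernel of the linear extensions is an ideal:
  extending \<open>\<phi>\<close> and evaluating at \<open>m \<otimes> p\<close> is the same as extending the translate of \<open>\<phi>\<close> by \<open>m\<close> and
  evaluating at \<open>p\<close>. Hence, if this kernel contains the relations, it contains the ideal that they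
  generate.
\<close>

lemma lin_extend_genideal:
  assumes "linear_space C"
    and closed: "\<And>\<phi>. \<phi> \<in> \<Phi> \<Longrightarrow> \<phi> \<in> carrier M \<rightarrow> carrier C"
    and left: "\<And>\<phi> m. \<phi> \<in> \<Phi> \<Longrightarrow> m \<in> carrier M \<Longrightarrow> (\<lambda>n. \<phi> (m \<otimes> n)) \<in> \<Phi>"
    and right: "\<And>\<phi> m. \<phi> \<in> \<Phi> \<Longrightarrow> m \<in> carrier M \<Longrightarrow> (\<lambda>n. \<phi> (n \<otimes> m)) \<in> \<Phi>"
    and rel: "\<And>\<phi> r. \<phi> \<in> \<Phi> \<Longrightarrow> r \<in> R \<Longrightarrow> lin_extend C \<phi> r = \<zero>\<^bsub>C\<^esub>"
    and "\<phi> \<in> \<Phi>" "p \<in> Idl\<^bsub>A\<^esub> R"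
  shows "lin_extend C \<phi> p = \<zero>\<^bsub>C\<^esub>"
proof -
  interpret C: linear_space C by fact
  define J where "J = {p \<in> carrier A. \<forall>\<phi>\<in>\<Phi>. lin_extend C \<phi> p = \<zero>\<^bsub>C\<^esub>}"
  have single_mult: "lin_extend C \<phi> (Poly_Mapping.single m c \<otimes>\<^bsub>A\<^esub> p) = c \<odot>\<^bsub>C\<^esub> lin_extend C (\<lambda>n. \<phi> (m \<otimes> n)) p"
    "lin_extend C \<phi> (p \<otimes>\<^bsub>A\<^esub> Poly_Mapping.single m c) = c \<odot>\<^bsub>C\<^esub> lin_extend C (\<lambda>n. \<phi> (n \<otimes> m)) p"
    if p: "Poly_Mapping.keys p \<subseteq> carrier M" and m: "m \<in> carrier M" and \<phi>: "\<phi> \<in> \<Phi>" for p m c \<phi>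
  proof -
    note cl = closed[OF \<phi>] closed[OF left[OF \<phi> m]] closed[OF right[OF \<phi> m]]
    have mkeys: "Poly_Mapping.keys (Poly_Mapping.single m c) \<subseteq> carrier M" using m by simp
    show "lin_extend C \<phi> (Poly_Mapping.single m c \<otimes>\<^bsub>A\<^esub> p) = c \<odot>\<^bsub>C\<^esub> lin_extend C (\<lambda>n. \<phi> (m \<otimes> n)) p"
      using p
    proof (induction rule: poly_mapping_induct_singles)
      case (single n d)
      then show ?case using m cl by (simp add: monoid_algebra_mult_single C.lin_extend_single Pi_iff C.smult_smult)
    next
      case (add p q)
      then show ?case
        by (simp add: monoid_algebra_mult_add_right C.lin_extend_add[OF _ _ cl(1)] C.lin_extend_add[OF _ _ cl(2)]
            monoid_algebra_mult_keys[OF mkeys] C.smult_r_distr C.lin_extend_closed[OF _ cl(2)])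
    qed (simp add: monoid_algebra_mult_zero C.lin_extend_zero)
    show "lin_extend C \<phi> (p \<otimes>\<^bsub>A\<^esub> Poly_Mapping.single m c) = c \<odot>\<^bsub>C\<^esub> lin_extend C (\<lambda>n. \<phi> (n \<otimes> m)) p"
      using p
    proof (induction rule: poly_mapping_induct_singles)
      case (single n d)
      then show ?case using m cl
        by (simp add: monoid_algebra_mult_single C.lin_extend_single Pi_iff C.smult_smult mult.commute)
    next
      case (add p q)
      then show ?case
        by (simp add: monoid_algebra_mult_add_left C.lin_extend_add[OF _ _ cl(1)] C.lin_extend_add[OF _ _ cl(3)]
            monoid_algebra_mult_keys[OF _ mkeys] C.smult_r_distr C.lin_extend_closed[OF _ cl(3)])
    qed (simp add: monoid_algebra_mult_zero C.lin_extend_zero)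
  qed
  have mult: "q \<otimes>\<^bsub>A\<^esub> p \<in> J" "p \<otimes>\<^bsub>A\<^esub> q \<in> J" if p: "p \<in> J" and q: "q \<in> carrier A" for p q
  proof -
    have pk: "Poly_Mapping.keys p \<subseteq> carrier M" using p by (simp add: J_def monoid_algebra_sel)
    have "Poly_Mapping.keys q \<subseteq> carrier M" using q by (simp add: monoid_algebra_sel)
    then have "lin_extend C \<phi> (q \<otimes>\<^bsub>A\<^esub> p) = \<zero>\<^bsub>C\<^esub> \<and> lin_extend C \<phi> (p \<otimes>\<^bsub>A\<^esub> q) = \<zero>\<^bsub>C\<^esub>" if "\<phi> \<in> \<Phi>" for \<phi>
    proof (induction rule: poly_mapping_induct_singles)
      case (single m c)
      have "lin_extend C (\<lambda>n. \<phi> (m \<otimes> n)) p = \<zero>\<^bsub>C\<^esub>" "lin_extend C (\<lambda>n. \<phi> (n \<otimes> m)) p = \<zero>\<^bsub>C\<^esub>"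
        using p left[OF that single] right[OF that single] unfolding J_def by blast+
      then show ?case by (simp only: single_mult[OF pk single that] C.smult_0_right simp_thms)
    next
      case (add q r)
      then show ?case using pk
        by (simp add: monoid_algebra_mult_add_left monoid_algebra_mult_add_right
            C.lin_extend_add[OF _ _ closed[OF that]] monoid_algebra_mult_keys)
    qed (simp add: monoid_algebra_mult_zero C.lin_extend_zero)
    then show "q \<otimes>\<^bsub>A\<^esub> p \<in> J" "p \<otimes>\<^bsub>A\<^esub> q \<in> J"
      using p q by (auto simp: J_def)
  qed
  have "ideal J A"
  proof (rule idealI)
    show "subgroup J (add_monoid A)"
    proof (rule A.add.subgroupI)
      fix p assume p: "p \<in> J"
      then have "\<ominus>\<^bsub>A\<^esub> p = \<ominus>\<^bsub>A\<^esub> \<one>\<^bsub>A\<^esub> \<otimes>\<^bsub>A\<^esub> p" by (simp add: J_def A.l_minus)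
      then show "\<ominus>\<^bsub>A\<^esub> p \<in> J" using mult(1)[OF p, of "\<ominus>\<^bsub>A\<^esub> \<one>\<^bsub>A\<^esub>"] by simp
    next
      fix p q assume "p \<in> J" "q \<in> J"
      then show "p \<oplus>\<^bsub>A\<^esub> q \<in> J"
        by (auto simp: J_def monoid_algebra_sel keys_add_subset C.lin_extend_add[OF _ _ closed])
    next
      have "\<zero>\<^bsub>A\<^esub> \<in> J" by (simp add: J_def monoid_algebra_sel C.lin_extend_zero)
      then show "J \<noteq> {}" by auto
    qed (auto simp: J_def)
  qed (use mult A.ring_axioms in auto)
  moreover have "R \<subseteq> J"
    using rel relations_subset by (auto simp: J_def)
  ultimately have "p \<in> J" using assms(7) A.genideal_minimal by blast
  then show ?thesis using assms(6) by (simp add: J_def)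
qed

text \<open>
  Under the third hypothesis all representatives of a coset have the same value, so the image of the
  coset is a singleton, and \<open>the_elem\<close> picks that value.
\<close>

lemma quot_lift_linear:
  assumes "linear_space C" and \<phi>: "\<phi> \<in> carrier M \<rightarrow> carrier C"
    and zero: "\<And>p. p \<in> Idl\<^bsub>A\<^esub> R \<Longrightarrow> lin_extend C \<phi> p = \<zero>\<^bsub>C\<^esub>"
  shows "quot_lift C \<phi> \<in> linear_maps Q C" (is ?linear)
    and "m \<in> carrier M \<Longrightarrow> quot_lift C \<phi> (cls m) = \<phi> m"
proof -
  interpret C: linear_space C by fact
  have lift: "quot_lift C \<phi> (quot_class A R p) = lin_extend C \<phi> p" if p: "Poly_Mapping.keys p \<subseteq> carrier M" for p
  proof -
    have "lin_extend C \<phi> q = lin_extend C \<phi> p" if "q \<in> quot_class A R p" for q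
    proof -
      obtain i where i: "i \<in> Idl\<^bsub>A\<^esub> R" "q = i + p"
        using \<open>q \<in> _\<close> unfolding A.mem_quot_class monoid_algebra_sel by blast
      have "Poly_Mapping.keys i \<subseteq> carrier M" using A.a_Hcarr[OF i(1)] by (simp add: monoid_algebra_sel)
      then show ?thesis
        unfolding i(2) C.lin_extend_add[OF \<open>Poly_Mapping.keys i \<subseteq> _\<close> p \<phi>] zero[OF i(1)]
        by (intro C.l_zero C.lin_extend_closed[OF p \<phi>])
    qed
    moreover have "p \<in> quot_class A R p"
      using p by (intro A.quot_class_self) (simp add: monoid_algebra_sel)
    ultimately have "lin_extend C \<phi> ` quot_class A R p = {lin_extend C \<phi> p}" by blast
    then show ?thesis by (simp add: quot_lift_def)
  qed
  show ?linear
  proof (rule linear_mapsI)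
    fix X assume "X \<in> carrier Q"
    then obtain p where p: "X = quot_class A R p" "Poly_Mapping.keys p \<subseteq> carrier M"
      by (auto simp: A.quot_algebra_sel monoid_algebra_sel)
    then show "quot_lift C \<phi> X \<in> carrier C" by (simp add: lift C.lin_extend_closed[OF _ \<phi>])
    fix c
    have "Poly_Mapping.keys (Poly_Mapping.map ((*) c) p) \<subseteq> carrier M" using p keys_map_times[of c p] by blast
    moreover have "c \<odot>\<^bsub>Q\<^esub> X = quot_class A R (Poly_Mapping.map ((*) c) p)"
      using p A.quot_class_smult[of p c] by (simp add: monoid_algebra_sel)
    ultimately show "quot_lift C \<phi> (c \<odot>\<^bsub>Q\<^esub> X) = c \<odot>\<^bsub>C\<^esub> quot_lift C \<phi> X"
      using p by (simp add: lift C.lin_extend_smult[OF p(2) \<phi>])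
  next
    fix X Y assume "X \<in> carrier Q" "Y \<in> carrier Q"
    then obtain p q where p: "X = quot_class A R p" "Poly_Mapping.keys p \<subseteq> carrier M"
      and q: "Y = quot_class A R q" "Poly_Mapping.keys q \<subseteq> carrier M"
      by (auto simp: A.quot_algebra_sel monoid_algebra_sel)
    have "X \<oplus>\<^bsub>Q\<^esub> Y = quot_class A R (p + q)"
      using p q A.quot_class_add[of p q] by (simp add: monoid_algebra_sel)
    then show "quot_lift C \<phi> (X \<oplus>\<^bsub>Q\<^esub> Y) = quot_lift C \<phi> X \<oplus>\<^bsub>C\<^esub> quot_lift C \<phi> Y"
      using p q by (simp add: lift keys_add_subset C.lin_extend_add[OF _ _ \<phi>])
  qed
  show "quot_lift C \<phi> (cls m) = \<phi> m" if "m \<in> carrier M"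
    using that \<phi> by (simp add: cls_def lift C.lin_extend_single Pi_iff)
qed

lemma quot_class_relation_diff:
  assumes "Poly_Mapping.keys p \<subseteq> carrier M" "Poly_Mapping.keys q \<subseteq> carrier M" "p - q \<in> R"
  shows "quot_class A R p = quot_class A R q"
proof -
  have "p - q \<in> Idl\<^bsub>A\<^esub> R" using assms(3) A.genideal_self relations_subset by blast
  then have "quot_class A R ((p - q) + q) = quot_class A R q"
    using A.quot_class_eqI[of q "p - q"] assms(2) by (simp add: monoid_algebra_sel)
  then show ?thesis by simp
qed

lemma cls_relation_add:
  assumes "m \<in> carrier M" "n \<in> carrier M" "l \<in> carrier M"
    and "Poly_Mapping.single m 1 - Poly_Mapping.single n 1 - Poly_Mapping.single l 1 \<in> R"
  shows "cls m = cls n \<oplus>\<^bsub>Q\<^esub> cls l"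
proof -
  let ?s = "\<lambda>m. Poly_Mapping.single m (1::'k)"
  have "quot_class A R (?s m) = quot_class A R (?s n + ?s l)"
    using assms by (intro quot_class_relation_diff keys_add_subset) (simp_all add: diff_diff_eq)
  also have "\<dots> = cls n \<oplus>\<^bsub>Q\<^esub> cls l"
    using assms A.quot_class_add[of "?s n" "?s l"] by (simp add: cls_def monoid_algebra_sel)
  finally show ?thesis by (simp add: cls_def)
qed

lemma cls_relation_smult:
  assumes "m \<in> carrier M" "n \<in> carrier M"
    and "Poly_Mapping.single m 1 - Poly_Mapping.single n c \<in> R"
  shows "cls m = c \<odot>\<^bsub>Q\<^esub> cls n"
proof -
  have "cls m = quot_class A R (Poly_Mapping.single n c)"
    unfolding cls_def using assms by (intro quot_class_relation_diff) simp_all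
  then show ?thesis by (simp add: quot_class_single assms(2))
qed

end

section \<open>Tensor products\<close>

locale algebra_pair = A: unital_algebra A + B: unital_algebra B
  for A :: "('k::field, 'a) module" and B :: "('k, 'b) module"
begin

sublocale tensor: presentation "A \<times>\<times> B" "tensor_relations A B"
proof (intro presentation.intro presentation_axioms.intro)
  show "Group.monoid (A \<times>\<times> B)"
    by (intro DirProd_monoid A.monoid_axioms B.monoid_axioms)
  show "tensor_relations A B \<subseteq> carrier (monoid_algebra (A \<times>\<times> B))"
  proof
    fix r assume "r \<in> tensor_relations A B"
    then have "Poly_Mapping.keys r \<subseteq> carrier (A \<times>\<times> B)"
      unfolding tensor_relations_def
      by (elim UnE CollectE exE conjE) (simp_all add: keys_diff_subset)
    then show "r \<in> carrier (monoid_algebra (A \<times>\<times> B))" by (simp add: monoid_algebra_def)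
  qed
qed

abbreviation "T \<equiv> tensor_algebra A B"

lemma tensor_eq: "quot_algebra (monoid_algebra (A \<times>\<times> B)) (tensor_relations A B) = T"
  by (simp add: tensor_algebra_def)

lemma pure_eq: "tensor.cls (a, b) = pure_tensor A B a b"
  by (simp add: tensor.cls_def pure_tensor_def)

lemmas unital_algebra_tensor = tensor.Q.unital_algebra_axioms[unfolded tensor_eq]

lemma pure_tensor_closed [simp]:
  "a \<in> carrier A \<Longrightarrow> b \<in> carrier B \<Longrightarrow> pure_tensor A B a b \<in> carrier T"
  using tensor.cls_closed[of "(a, b)"] by (simp add: tensor_eq pure_eq)

lemma pure_tensor_mult:
  "a \<in> carrier A \<Longrightarrow> b \<in> carrier B \<Longrightarrow> a' \<in> carrier A \<Longrightarrow> b' \<in> carrier B \<Longrightarrow>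
    pure_tensor A B a b \<otimes>\<^bsub>T\<^esub> pure_tensor A B a' b' = pure_tensor A B (a \<otimes>\<^bsub>A\<^esub> a') (b \<otimes>\<^bsub>B\<^esub> b')"
  using tensor.cls_mult[of "(a, b)" "(a', b')"] by (simp add: tensor_eq pure_eq)

lemma pure_tensor_one: "\<one>\<^bsub>T\<^esub> = pure_tensor A B \<one>\<^bsub>A\<^esub> \<one>\<^bsub>B\<^esub>"
  using tensor.cls_one by (simp add: tensor_eq pure_eq)

lemma bilinear_map_pure_tensor: "bilinear_map A B T (pure_tensor A B)"
proof -
  note rels = tensor.cls_relation_add tensor.cls_relation_smult
  show ?thesis
    unfolding bilinear_map_def tensor_eq[symmetric] pure_eq[symmetric]
    by (intro conjI ballI allI rels tensor.cls_closed) (auto simp: tensor_relations_def)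
qed

lemma tensor_induct [consumes 1, case_names pure add smult]:
  assumes "X \<in> carrier T"
    and "\<And>a b. a \<in> carrier A \<Longrightarrow> b \<in> carrier B \<Longrightarrow> P (pure_tensor A B a b)"
    and "\<And>X Y. X \<in> carrier T \<Longrightarrow> Y \<in> carrier T \<Longrightarrow> P X \<Longrightarrow> P Y \<Longrightarrow> P (X \<oplus>\<^bsub>T\<^esub> Y)"
    and "\<And>c X. X \<in> carrier T \<Longrightarrow> P X \<Longrightarrow> P (c \<odot>\<^bsub>T\<^esub> X)"
  shows "P X"
  using assms(1)[folded tensor_eq]
proof (induction rule: tensor.quot_induct)
  case (cls m)
  then show ?case using assms(2)[of "fst m" "snd m"] by (cases m) (simp add: pure_eq)
qed (use assms(3,4) tensor_eq in auto)

lemma linear_maps_tensor_eqI: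
  assumes "f \<in> linear_maps T C" "g \<in> linear_maps T C"
    and "\<And>a b. a \<in> carrier A \<Longrightarrow> b \<in> carrier B \<Longrightarrow> f (pure_tensor A B a b) = g (pure_tensor A B a b)"
    and "X \<in> carrier T"
  shows "f X = g X"
  using assms(4)
  by (induction rule: tensor_induct) (simp_all add: assms(3) linear_mapsD[OF assms(1)] linear_mapsD[OF assms(2)])

text \<open>
  The family of all bilinear maps into \<open>C\<close> is stable under translations, as
  \<open>(c, d) \<mapsto> \<gamma> (a c) (b d)\<close> is bilinear when \<open>\<gamma>\<close> is, and the relations of the tensor product say
  exactly that bilinear maps vanish on them.
\<close>

lemma tensor_lift_linear:
  assumes "linear_space C" "bilinear_map A B C \<beta>"
  shows "tensor_lift C \<beta> \<in> linear_maps T C"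
    and "a \<in> carrier A \<Longrightarrow> b \<in> carrier B \<Longrightarrow> tensor_lift C \<beta> (pure_tensor A B a b) = \<beta> a b"
proof -
  interpret C: linear_space C by fact
  let ?\<Phi> = "{(\<lambda>(a, b). \<gamma> a b) | \<gamma>. bilinear_map A B C \<gamma>}"
  have zero: "lin_extend C (\<lambda>(a, b). \<beta> a b) p = \<zero>\<^bsub>C\<^esub>"
    if "p \<in> Idl\<^bsub>monoid_algebra (A \<times>\<times> B)\<^esub> (tensor_relations A B)" for p
  proof (rule tensor.lin_extend_genideal[where \<Phi> = ?\<Phi>, OF \<open>linear_space C\<close> _ _ _ _ _ that])
    fix \<phi> assume "\<phi> \<in> ?\<Phi>"
    then obtain \<gamma> where \<phi>: "\<phi> = (\<lambda>(a, b). \<gamma> a b)" and \<gamma>: "bilinear_map A B C \<gamma>" by auto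
    show closed: "\<phi> \<in> carrier (A \<times>\<times> B) \<rightarrow> carrier C"
      using \<gamma> by (auto simp: \<phi> bilinear_map_def)
    {
      fix m assume "m \<in> carrier (A \<times>\<times> B)"
      then obtain a b where m: "m = (a, b)" "a \<in> carrier A" "b \<in> carrier B" by auto
      have "(\<lambda>n. \<phi> (m \<otimes>\<^bsub>A \<times>\<times> B\<^esub> n)) = (\<lambda>(c, d). \<gamma> (a \<otimes>\<^bsub>A\<^esub> c) (b \<otimes>\<^bsub>B\<^esub> d))"
        "(\<lambda>n. \<phi> (n \<otimes>\<^bsub>A \<times>\<times> B\<^esub> m)) = (\<lambda>(c, d). \<gamma> (c \<otimes>\<^bsub>A\<^esub> a) (d \<otimes>\<^bsub>B\<^esub> b))"
        by (auto simp: fun_eq_iff m \<phi>)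
      moreover have "bilinear_map A B C (\<lambda>c d. \<gamma> (a \<otimes>\<^bsub>A\<^esub> c) (b \<otimes>\<^bsub>B\<^esub> d))"
        "bilinear_map A B C (\<lambda>c d. \<gamma> (c \<otimes>\<^bsub>A\<^esub> a) (d \<otimes>\<^bsub>B\<^esub> b))"
        using m bilinear_mapD[OF A.bilinear_map_mult] bilinear_mapD[OF B.bilinear_map_mult]
        by (auto intro!: bilinear_map_comp[OF \<gamma>])
      ultimately show "(\<lambda>n. \<phi> (m \<otimes>\<^bsub>A \<times>\<times> B\<^esub> n)) \<in> ?\<Phi>" "(\<lambda>n. \<phi> (n \<otimes>\<^bsub>A \<times>\<times> B\<^esub> m)) \<in> ?\<Phi>"
        by blast+
    }
    fix r assume r: "r \<in> tensor_relations A B"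
    have \<gamma>': "a \<in> carrier A \<Longrightarrow> b \<in> carrier B \<Longrightarrow> \<gamma> a b \<in> carrier C" for a b
      using \<gamma> by (auto simp: bilinear_map_def)
    have L: "lin_extend C \<phi> (Poly_Mapping.single (a, b) c) = c \<odot>\<^bsub>C\<^esub> \<gamma> a b"
      if "a \<in> carrier A" "b \<in> carrier B" for a b c
      using that by (simp add: C.lin_extend_single \<phi> \<gamma>')
    note simps = C.lin_extend_diff[OF _ _ closed] keys_diff_subset L \<gamma>' C.minus_eq C.minus_add C.r_neg C.a_assoc
      C.r_neg1 C.r_neg2
    from r show "lin_extend C \<phi> r = \<zero>\<^bsub>C\<^esub>"
      unfolding tensor_relations_def
    proof (elim UnE CollectE exE conjE)
      fix a a' b assume *: "r = Poly_Mapping.single (a \<oplus>\<^bsub>A\<^esub> a', b) 1 - Poly_Mapping.single (a, b) 1 - Poly_Mapping.single (a', b) 1"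
        "a \<in> carrier A" "a' \<in> carrier A" "b \<in> carrier B"
      then have "\<gamma> (a \<oplus>\<^bsub>A\<^esub> a') b = \<gamma> a b \<oplus>\<^bsub>C\<^esub> \<gamma> a' b" using \<gamma> by (auto simp: bilinear_map_def)
      then show ?thesis using * by (simp add: simps C.a_comm[of "\<gamma> a' b"])
    next
      fix a b b' assume *: "r = Poly_Mapping.single (a, b \<oplus>\<^bsub>B\<^esub> b') 1 - Poly_Mapping.single (a, b) 1 - Poly_Mapping.single (a, b') 1"
        "a \<in> carrier A" "b \<in> carrier B" "b' \<in> carrier B"
      then have "\<gamma> a (b \<oplus>\<^bsub>B\<^esub> b') = \<gamma> a b \<oplus>\<^bsub>C\<^esub> \<gamma> a b'" using \<gamma> by (auto simp: bilinear_map_def)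
      then show ?thesis using * by (simp add: simps C.a_comm[of "\<gamma> a b'"])
    next
      fix c a b assume *: "r = Poly_Mapping.single (c \<odot>\<^bsub>A\<^esub> a, b) 1 - Poly_Mapping.single (a, b) c"
        "a \<in> carrier A" "b \<in> carrier B"
      then have "\<gamma> (c \<odot>\<^bsub>A\<^esub> a) b = c \<odot>\<^bsub>C\<^esub> \<gamma> a b" using \<gamma> by (auto simp: bilinear_map_def)
      then show ?thesis using * by (simp add: simps)
    next
      fix c a b assume *: "r = Poly_Mapping.single (a, c \<odot>\<^bsub>B\<^esub> b) 1 - Poly_Mapping.single (a, b) c"
        "a \<in> carrier A" "b \<in> carrier B"
      then have "\<gamma> a (c \<odot>\<^bsub>B\<^esub> b) = c \<odot>\<^bsub>C\<^esub> \<gamma> a b" using \<gamma> by (auto simp: bilinear_map_def)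
      then show ?thesis using * by (simp add: simps)
    qed
  qed (use assms(2) in blast)
  have closed: "(\<lambda>(a, b). \<beta> a b) \<in> carrier (A \<times>\<times> B) \<rightarrow> carrier C"
    using assms(2) by (auto simp: bilinear_map_def)
  note lift = tensor.quot_lift_linear[OF assms(1) closed zero, folded tensor_lift_def, unfolded tensor_eq]
  show "tensor_lift C \<beta> \<in> linear_maps T C" by (rule lift(1))
  show "tensor_lift C \<beta> (pure_tensor A B a b) = \<beta> a b" if "a \<in> carrier A" "b \<in> carrier B"
    using lift(2)[of "(a, b)"] that by (simp add: pure_eq)
qed

end

section \<open>Universal enveloping algebras\<close>

lemma list_prod_simps: "list_prod A [] = \<one>\<^bsub>A\<^esub>" "list_prod A (a # as) = a \<otimes>\<^bsub>A\<^esub> list_prod A as"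
  by (simp_all add: list_prod_def)

lemma (in monoid) list_prod_closed: "set as \<subseteq> carrier G \<Longrightarrow> list_prod G as \<in> carrier G"
  by (induction as) (simp_all add: list_prod_simps)

lemma (in monoid) list_prod_append:
  "set as \<subseteq> carrier G \<Longrightarrow> set bs \<subseteq> carrier G \<Longrightarrow> list_prod G (as @ bs) = list_prod G as \<otimes> list_prod G bs"
  by (induction as) (simp_all add: list_prod_simps list_prod_closed m_assoc)

locale enveloping =
  fixes scale :: "'k::field \<Rightarrow> 'g::ab_group_add \<Rightarrow> 'g" and bracket :: "'g \<Rightarrow> 'g \<Rightarrow> 'g"
begin

abbreviation "U \<equiv> uea scale bracket"
abbreviation "\<iota> \<equiv> uea_gen scale bracket"

sublocale words: presentation "word_monoid" "uea_relations scale bracket"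
proof (intro presentation.intro presentation_axioms.intro)
  show "Group.monoid (word_monoid :: 'g list monoid)" by (rule monoidI) (auto simp: word_monoid_def)
qed (auto simp: monoid_algebra_def word_monoid_def)

lemma U_eq: "quot_algebra (monoid_algebra word_monoid) (uea_relations scale bracket) = U"
  by (simp add: uea_def)

lemma gen_eq: "words.cls [x] = \<iota> x"
  by (simp add: words.cls_def uea_gen_def)

lemma word_monoid_sel [simp]: "carrier word_monoid = UNIV" "u \<otimes>\<^bsub>word_monoid\<^esub> v = u @ v" "\<one>\<^bsub>word_monoid\<^esub> = []"
  by (simp_all add: word_monoid_def)

sublocale unital_algebra "uea scale bracket"
  using words.Q.unital_algebra_axioms by (simp add: U_eq)

lemma gen_closed [simp]: "\<iota> x \<in> carrier U"
  using words.cls_closed[of "[x]"] by (simp add: U_eq gen_eq)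

lemma word_append: "words.cls (u @ v) = words.cls u \<otimes>\<^bsub>U\<^esub> words.cls v"
  using words.cls_mult[of u v] by (simp add: U_eq)

lemma word_cons: "words.cls (x # w) = \<iota> x \<otimes>\<^bsub>U\<^esub> words.cls w"
  using words.cls_mult[of "[x]" w] by (simp add: U_eq gen_eq)

lemma word_closed [simp]: "words.cls w \<in> carrier U"
  using words.cls_closed[of w] by (simp add: U_eq)

lemma word_nil: "words.cls [] = \<one>\<^bsub>U\<^esub>"
  using words.cls_one by (simp add: U_eq)

lemma gen_add: "\<iota> (x + y) = \<iota> x \<oplus>\<^bsub>U\<^esub> \<iota> y"
  unfolding gen_eq[symmetric] U_eq[symmetric]
  by (rule words.cls_relation_add) (auto simp: uea_relations_def)

lemma gen_scale: "\<iota> (scale c x) = c \<odot>\<^bsub>U\<^esub> \<iota> x"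
  unfolding gen_eq[symmetric] U_eq[symmetric]
  by (rule words.cls_relation_smult) (auto simp: uea_relations_def)

lemma gen_zero: "\<iota> 0 = \<zero>\<^bsub>U\<^esub>"
  using gen_add[of 0 0] by (metis add.r_cancel_one' add_0 gen_closed)

lemma gen_uminus: "\<iota> (- x) = \<ominus>\<^bsub>U\<^esub> \<iota> x"
  using gen_add[of "- x" x] by (simp add: gen_zero minus_equality)

lemma gen_bracket: "\<iota> x \<otimes>\<^bsub>U\<^esub> \<iota> y = \<iota> y \<otimes>\<^bsub>U\<^esub> \<iota> x \<oplus>\<^bsub>U\<^esub> \<iota> (bracket x y)"
proof -
  have "words.cls [x, y] = words.cls [y, x] \<oplus>\<^bsub>U\<^esub> words.cls [bracket x y]"
    unfolding U_eq[symmetric] by (rule words.cls_relation_add) (auto simp: uea_relations_def)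
  then show ?thesis by (simp add: word_cons word_nil)
qed

lemma uea_induct [consumes 1, case_names one gen add smult]:
  assumes "X \<in> carrier U" and one: "P \<one>\<^bsub>U\<^esub>"
    and gen: "\<And>x X. X \<in> carrier U \<Longrightarrow> P X \<Longrightarrow> P (\<iota> x \<otimes>\<^bsub>U\<^esub> X)"
    and add: "\<And>X Y. X \<in> carrier U \<Longrightarrow> Y \<in> carrier U \<Longrightarrow> P X \<Longrightarrow> P Y \<Longrightarrow> P (X \<oplus>\<^bsub>U\<^esub> Y)"
    and smult: "\<And>c X. X \<in> carrier U \<Longrightarrow> P X \<Longrightarrow> P (c \<odot>\<^bsub>U\<^esub> X)"
  shows "P X"
  using assms(1)[folded U_eq]
proof (induction rule: words.quot_induct)
  case (cls w)
  show ?case by (induction w) (simp_all add: word_nil word_cons one gen)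
qed (use add smult U_eq in auto)

text \<open>
  The universal property. Here the family stable under translations consists of the maps that send a
  word \<open>w\<close> to \<open>a f(w) b\<close> with \<open>a\<close> and \<open>b\<close> in \<open>B\<close>, where \<open>f(w)\<close> is the product of the values at the
  letters; the word map itself is the case \<open>a = b = 1\<close>.
\<close>

lemma uea_lift_hom:
  assumes "unital_algebra B"
    and f_closed: "\<And>x. f x \<in> carrier B"
    and f_add: "\<And>x y. f (x + y) = f x \<oplus>\<^bsub>B\<^esub> f y"
    and f_scale: "\<And>c x. f (scale c x) = c \<odot>\<^bsub>B\<^esub> f x"
    and f_bracket: "\<And>x y. f x \<otimes>\<^bsub>B\<^esub> f y = f y \<otimes>\<^bsub>B\<^esub> f x \<oplus>\<^bsub>B\<^esub> f (bracket x y)"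
  shows "uea_lift B f \<in> linear_maps U B"
    and "uea_lift B f \<one>\<^bsub>U\<^esub> = \<one>\<^bsub>B\<^esub>"
    and "uea_lift B f (\<iota> x) = f x"
    and "X \<in> carrier U \<Longrightarrow> Y \<in> carrier U \<Longrightarrow> uea_lift B f (X \<otimes>\<^bsub>U\<^esub> Y) = uea_lift B f X \<otimes>\<^bsub>B\<^esub> uea_lift B f Y"
proof -
  interpret B: unital_algebra B by fact
  let ?f = "\<lambda>w. list_prod B (map f w)"
  have fc: "set (map f w) \<subseteq> carrier B" for w using f_closed by auto
  note fc' [simp] = B.list_prod_closed[OF fc]
  have f_app: "?f (u @ v) = ?f u \<otimes>\<^bsub>B\<^esub> ?f v" for u v
    by (simp only: map_append B.list_prod_append[OF fc fc])
  let ?\<Phi> = "{(\<lambda>w. a \<otimes>\<^bsub>B\<^esub> ?f w \<otimes>\<^bsub>B\<^esub> b) | a b. a \<in> carrier B \<and> b \<in> carrier B}"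
  have zero: "lin_extend B ?f p = \<zero>\<^bsub>B\<^esub>"
    if "p \<in> Idl\<^bsub>monoid_algebra word_monoid\<^esub> (uea_relations scale bracket)" for p
  proof (rule words.lin_extend_genideal[where \<Phi> = ?\<Phi>, OF B.linear_space_axioms _ _ _ _ _ that])
    show "?f \<in> ?\<Phi>" by (auto intro!: exI[of _ "\<one>\<^bsub>B\<^esub>"])
  next
    fix \<phi> assume "\<phi> \<in> ?\<Phi>"
    then obtain a b where \<phi>: "\<phi> = (\<lambda>w. a \<otimes>\<^bsub>B\<^esub> ?f w \<otimes>\<^bsub>B\<^esub> b)" and ab: "a \<in> carrier B" "b \<in> carrier B" by auto
    show closed: "\<phi> \<in> carrier word_monoid \<rightarrow> carrier B" using ab by (auto simp: \<phi>)
    {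
      fix m :: "'g list"
      have "(\<lambda>n. \<phi> (m \<otimes>\<^bsub>word_monoid\<^esub> n)) = (\<lambda>w. (a \<otimes>\<^bsub>B\<^esub> ?f m) \<otimes>\<^bsub>B\<^esub> ?f w \<otimes>\<^bsub>B\<^esub> b)"
        "(\<lambda>n. \<phi> (n \<otimes>\<^bsub>word_monoid\<^esub> m)) = (\<lambda>w. a \<otimes>\<^bsub>B\<^esub> ?f w \<otimes>\<^bsub>B\<^esub> (?f m \<otimes>\<^bsub>B\<^esub> b))"
        using ab by (simp_all add: \<phi> f_app B.m_assoc del: map_append)
      then show "(\<lambda>n. \<phi> (m \<otimes>\<^bsub>word_monoid\<^esub> n)) \<in> ?\<Phi>" "(\<lambda>n. \<phi> (n \<otimes>\<^bsub>word_monoid\<^esub> m)) \<in> ?\<Phi>"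
        using ab fc' by blast+
    }
    fix r assume r: "r \<in> uea_relations scale bracket"
    have L: "lin_extend B \<phi> (Poly_Mapping.single w c) = c \<odot>\<^bsub>B\<^esub> (a \<otimes>\<^bsub>B\<^esub> ?f w \<otimes>\<^bsub>B\<^esub> b)" for w c
      using ab by (simp add: B.lin_extend_single \<phi>)
    have closed': "\<phi> \<in> UNIV \<rightarrow> carrier B" using closed by simp
    note simps = B.lin_extend_diff[OF _ _ closed'] L B.minus_eq B.minus_add B.r_neg B.a_assoc
      B.r_neg1 B.r_neg2 list_prod_simps f_closed f_add f_scale ab B.l_distr B.r_distr
      B.smult_mult_left B.smult_mult_right
    from r show "lin_extend B \<phi> r = \<zero>\<^bsub>B\<^esub>"
      unfolding uea_relations_def
    proof (elim UnE CollectE exE conjE)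
      fix x y assume *: "r = Poly_Mapping.single [x + y] 1 - Poly_Mapping.single [x] 1 - Poly_Mapping.single [y] 1"
      show ?thesis unfolding * by (simp add: simps B.a_comm[of "a \<otimes>\<^bsub>B\<^esub> f y \<otimes>\<^bsub>B\<^esub> b"])
    next
      fix c x assume *: "r = Poly_Mapping.single [scale c x] 1 - Poly_Mapping.single [x] c"
      show ?thesis unfolding * by (simp add: simps)
    next
      fix x y assume *: "r = Poly_Mapping.single [x, y] 1 - Poly_Mapping.single [y, x] 1 - Poly_Mapping.single [bracket x y] 1"
      show ?thesis unfolding *
        by (simp add: simps f_bracket[of x y] B.a_comm[of "a \<otimes>\<^bsub>B\<^esub> f (bracket x y) \<otimes>\<^bsub>B\<^esub> b"])
    qed
  qed
  have closed: "?f \<in> carrier word_monoid \<rightarrow> carrier B" by simp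
  note lift = words.quot_lift_linear[OF B.linear_space_axioms closed zero, folded uea_lift_def, unfolded U_eq]
  show lin: "uea_lift B f \<in> linear_maps U B" by (rule lift(1))
  have word: "uea_lift B f (words.cls w) = ?f w" for w by (rule lift(2)) simp_all
  show one: "uea_lift B f \<one>\<^bsub>U\<^esub> = \<one>\<^bsub>B\<^esub>" using word[of "[]"] by (simp add: word_nil list_prod_simps)
  show "uea_lift B f (\<iota> x) = f x" using word[of "[x]"] by (simp add: gen_eq list_prod_simps f_closed)
  note linD = linear_mapsD[OF lin]
  show "uea_lift B f (X \<otimes>\<^bsub>U\<^esub> Y) = uea_lift B f X \<otimes>\<^bsub>B\<^esub> uea_lift B f Y" if "X \<in> carrier U" and Y: "Y \<in> carrier U"
    using that(1)[folded U_eq]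
  proof (induction rule: words.quot_induct)
    case (cls u)
    from Y[folded U_eq] show ?case
    proof (induction rule: words.quot_induct)
      case (cls v)
      show ?case unfolding U_eq word_append[symmetric] word f_app ..
    qed (simp_all add: U_eq linD r_distr smult_mult_right B.r_distr B.smult_mult_right)
  qed (simp_all add: U_eq Y linD l_distr smult_mult_left B.l_distr B.smult_mult_left)
qed

end

section \<open>The coproduct\<close>

context enveloping
begin

sublocale UU: algebra_pair "uea scale bracket" "uea scale bracket"
  by unfold_locales

sublocale UU.T: unital_algebra "tensor_algebra (uea scale bracket) (uea scale bracket)"
  by (rule UU.unital_algebra_tensor)

abbreviation "\<Delta> \<equiv> uea_coproduct scale bracket"
abbreviation "pure \<equiv> pure_tensor U U"

lemmas pure_tensor_linear = bilinear_mapD[OF UU.bilinear_map_pure_tensor]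

text \<open>
  The two summands \<open>\<iota> x \<otimes> 1\<close> and \<open>1 \<otimes> \<iota> y\<close> commute, so the commutator of the values at \<open>x\<close> and \<open>y\<close>
  is the value at the bracket, and the universal property applies.
\<close>

lemma coproduct_hom:
  shows coproduct_linear: "\<Delta> \<in> linear_maps U UU.T"
    and coproduct_one: "\<Delta> \<one>\<^bsub>U\<^esub> = \<one>\<^bsub>UU.T\<^esub>"
    and coproduct_gen: "\<Delta> (\<iota> x) = pure (\<iota> x) \<one>\<^bsub>U\<^esub> \<oplus>\<^bsub>UU.T\<^esub> pure \<one>\<^bsub>U\<^esub> (\<iota> x)"
    and coproduct_mult: "X \<in> carrier U \<Longrightarrow> Y \<in> carrier U \<Longrightarrow> \<Delta> (X \<otimes>\<^bsub>U\<^esub> Y) = \<Delta> X \<otimes>\<^bsub>UU.T\<^esub> \<Delta> Y"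
proof -
  let ?d = "\<lambda>x. pure (\<iota> x) \<one>\<^bsub>U\<^esub> \<oplus>\<^bsub>UU.T\<^esub> pure \<one>\<^bsub>U\<^esub> (\<iota> x)"
  have add: "?d (x + y) = ?d x \<oplus>\<^bsub>UU.T\<^esub> ?d y" for x y
    by (simp add: gen_add linear_mapsD(2)[OF pure_tensor_linear(1)] linear_mapsD(2)[OF pure_tensor_linear(2)] UU.T.a_ac)
  have scale: "?d (scale c x) = c \<odot>\<^bsub>UU.T\<^esub> ?d x" for c x
    by (simp add: gen_scale linear_mapsD(3)[OF pure_tensor_linear(1)] linear_mapsD(3)[OF pure_tensor_linear(2)]
        UU.T.smult_r_distr)
  have bracket: "?d x \<otimes>\<^bsub>UU.T\<^esub> ?d y = ?d y \<otimes>\<^bsub>UU.T\<^esub> ?d x \<oplus>\<^bsub>UU.T\<^esub> ?d (bracket x y)" for x y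
  proof -
    have "pure (\<iota> x \<otimes>\<^bsub>U\<^esub> \<iota> y) \<one>\<^bsub>U\<^esub> = pure (\<iota> y \<otimes>\<^bsub>U\<^esub> \<iota> x) \<one>\<^bsub>U\<^esub> \<oplus>\<^bsub>UU.T\<^esub> pure (\<iota> (bracket x y)) \<one>\<^bsub>U\<^esub>"
      "pure \<one>\<^bsub>U\<^esub> (\<iota> x \<otimes>\<^bsub>U\<^esub> \<iota> y) = pure \<one>\<^bsub>U\<^esub> (\<iota> y \<otimes>\<^bsub>U\<^esub> \<iota> x) \<oplus>\<^bsub>UU.T\<^esub> pure \<one>\<^bsub>U\<^esub> (\<iota> (bracket x y))"
      by (simp_all add: gen_bracket[of x y] linear_mapsD(2)[OF pure_tensor_linear(1)] linear_mapsD(2)[OF pure_tensor_linear(2)])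
    then show ?thesis
      by (simp add: UU.T.l_distr UU.T.r_distr UU.pure_tensor_mult UU.T.a_ac)
  qed
  have eq: "uea_lift UU.T ?d = \<Delta>"
    by (simp add: uea_coproduct_def Let_def)
  note hom = uea_lift_hom[where f = ?d, OF UU.T.unital_algebra_axioms _ add scale bracket, unfolded eq]
  show "\<Delta> \<in> linear_maps U UU.T" by (rule hom(1)) simp
  show "\<Delta> \<one>\<^bsub>U\<^esub> = \<one>\<^bsub>UU.T\<^esub>" by (rule hom(2)) simp
  show "\<Delta> (\<iota> x) = ?d x" by (rule hom(3)) simp
  show "\<Delta> (X \<otimes>\<^bsub>U\<^esub> Y) = \<Delta> X \<otimes>\<^bsub>UU.T\<^esub> \<Delta> Y" if "X \<in> carrier U" "Y \<in> carrier U"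
    by (rule hom(4)) (simp_all add: that)
qed

text \<open>
  In Sweedler notation, \<open>\<beta> X\<^sub>(\<^sub>1\<^sub>) X\<^sub>(\<^sub>2\<^sub>)\<close>. Both \<open>*\<close> and \<open>F\<close> have this form, so that identities about
  them become identities between bilinear maps \<open>\<beta>\<close>.
\<close>

definition sweedler :: "('k, 'c) module \<Rightarrow> (('g list \<Rightarrow>\<^sub>0 'k) set \<Rightarrow> ('g list \<Rightarrow>\<^sub>0 'k) set \<Rightarrow> 'c) \<Rightarrow> ('g list \<Rightarrow>\<^sub>0 'k) set \<Rightarrow> 'c"
  where "sweedler C \<beta> X = tensor_lift C \<beta> (\<Delta> X)"

lemma sweedler_linear: "linear_space C \<Longrightarrow> bilinear_map U U C \<beta> \<Longrightarrow> sweedler C \<beta> \<in> linear_maps U C"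
  unfolding sweedler_def[abs_def]
  by (rule linear_maps_comp[OF UU.tensor_lift_linear(1) coproduct_linear])

lemma sweedler_one: "linear_space C \<Longrightarrow> bilinear_map U U C \<beta> \<Longrightarrow> sweedler C \<beta> \<one>\<^bsub>U\<^esub> = \<beta> \<one>\<^bsub>U\<^esub> \<one>\<^bsub>U\<^esub>"
  unfolding sweedler_def by (simp add: coproduct_one UU.pure_tensor_one UU.tensor_lift_linear)

lemma bilinear_map_mult_args:
  assumes "bilinear_map U U C \<beta>" "Y \<in> carrier U"
  shows "bilinear_map U U C (\<lambda>a b. \<beta> (Y \<otimes>\<^bsub>U\<^esub> a) b)" "bilinear_map U U C (\<lambda>a b. \<beta> a (Y \<otimes>\<^bsub>U\<^esub> b))"
    "bilinear_map U U C (\<lambda>a b. \<beta> (a \<otimes>\<^bsub>U\<^esub> Y) b)" "bilinear_map U U C (\<lambda>a b. \<beta> a (b \<otimes>\<^bsub>U\<^esub> Y))"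
  using bilinear_mapD[OF bilinear_map_mult] assms(2)
  by (auto intro!: bilinear_map_comp[OF assms(1)] linear_maps_id)

text \<open>
  Generators are primitive and the coproduct is multiplicative, so a generator that multiplies \<open>X\<close>
  goes to one or the other tensor factor. Both sides are linear in the coproduct of \<open>X\<close>, which may be
  replaced by a pure tensor.
\<close>

lemma sweedler_gen_mult:
  assumes "linear_space C" and \<beta>: "bilinear_map U U C \<beta>" and X: "X \<in> carrier U"
  shows "sweedler C \<beta> (\<iota> x \<otimes>\<^bsub>U\<^esub> X) =
      sweedler C (\<lambda>a b. \<beta> (\<iota> x \<otimes>\<^bsub>U\<^esub> a) b) X \<oplus>\<^bsub>C\<^esub> sweedler C (\<lambda>a b. \<beta> a (\<iota> x \<otimes>\<^bsub>U\<^esub> b)) X"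
    and "sweedler C \<beta> (X \<otimes>\<^bsub>U\<^esub> \<iota> x) =
      sweedler C (\<lambda>a b. \<beta> (a \<otimes>\<^bsub>U\<^esub> \<iota> x) b) X \<oplus>\<^bsub>C\<^esub> sweedler C (\<lambda>a b. \<beta> a (b \<otimes>\<^bsub>U\<^esub> \<iota> x)) X"
proof -
  interpret C: linear_space C by fact
  note lift = UU.tensor_lift_linear[OF assms(1)]
  note bil = bilinear_map_mult_args[OF \<beta> gen_closed[of x]]
  have dc: "\<Delta> (\<iota> x) \<in> carrier UU.T" by (simp add: linear_mapsD[OF coproduct_linear])
  note mult_lin = bilinear_mapD[OF UU.T.bilinear_map_mult, OF dc]
  have \<Delta>X: "\<Delta> X \<in> carrier UU.T" using X by (simp add: linear_mapsD[OF coproduct_linear])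
  have "tensor_lift C \<beta> (\<Delta> (\<iota> x) \<otimes>\<^bsub>UU.T\<^esub> t) =
      tensor_lift C (\<lambda>a b. \<beta> (\<iota> x \<otimes>\<^bsub>U\<^esub> a) b) t \<oplus>\<^bsub>C\<^esub> tensor_lift C (\<lambda>a b. \<beta> a (\<iota> x \<otimes>\<^bsub>U\<^esub> b)) t"
    if "t \<in> carrier UU.T" for t
    by (rule UU.linear_maps_tensor_eqI[OF linear_maps_comp[OF lift(1)[OF \<beta>] mult_lin(2)]
          C.linear_maps_add[OF lift(1)[OF bil(1)] lift(1)[OF bil(2)]] _ that])
      (simp add: coproduct_gen UU.T.l_distr UU.pure_tensor_mult linear_mapsD[OF lift(1)[OF \<beta>]]
        lift(2)[OF \<beta>] lift(2)[OF bil(1)] lift(2)[OF bil(2)])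
  then show "sweedler C \<beta> (\<iota> x \<otimes>\<^bsub>U\<^esub> X) =
      sweedler C (\<lambda>a b. \<beta> (\<iota> x \<otimes>\<^bsub>U\<^esub> a) b) X \<oplus>\<^bsub>C\<^esub> sweedler C (\<lambda>a b. \<beta> a (\<iota> x \<otimes>\<^bsub>U\<^esub> b)) X"
    using X by (simp add: sweedler_def coproduct_mult \<Delta>X)
  have "tensor_lift C \<beta> (t \<otimes>\<^bsub>UU.T\<^esub> \<Delta> (\<iota> x)) =
      tensor_lift C (\<lambda>a b. \<beta> (a \<otimes>\<^bsub>U\<^esub> \<iota> x) b) t \<oplus>\<^bsub>C\<^esub> tensor_lift C (\<lambda>a b. \<beta> a (b \<otimes>\<^bsub>U\<^esub> \<iota> x)) t"
    if "t \<in> carrier UU.T" for t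
    by (rule UU.linear_maps_tensor_eqI[OF linear_maps_comp[OF lift(1)[OF \<beta>] mult_lin(1)]
          C.linear_maps_add[OF lift(1)[OF bil(3)] lift(1)[OF bil(4)]] _ that])
      (simp add: coproduct_gen UU.T.r_distr UU.pure_tensor_mult linear_mapsD[OF lift(1)[OF \<beta>]]
        lift(2)[OF \<beta>] lift(2)[OF bil(3)] lift(2)[OF bil(4)])
  then show "sweedler C \<beta> (X \<otimes>\<^bsub>U\<^esub> \<iota> x) =
      sweedler C (\<lambda>a b. \<beta> (a \<otimes>\<^bsub>U\<^esub> \<iota> x) b) X \<oplus>\<^bsub>C\<^esub> sweedler C (\<lambda>a b. \<beta> a (b \<otimes>\<^bsub>U\<^esub> \<iota> x)) X"
    using X by (simp add: sweedler_def coproduct_mult \<Delta>X)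
qed

lemma sweedler_gen:
  assumes "linear_space C" and \<beta>: "bilinear_map U U C \<beta>"
  shows "sweedler C \<beta> (\<iota> x) = \<beta> (\<iota> x) \<one>\<^bsub>U\<^esub> \<oplus>\<^bsub>C\<^esub> \<beta> \<one>\<^bsub>U\<^esub> (\<iota> x)"
  using sweedler_gen_mult(1)[OF assms one_closed, of x]
  by (simp add: sweedler_one[OF assms(1)] bilinear_map_mult_args[OF \<beta>])

lemma sweedler_cong:
  assumes "linear_space C" "bilinear_map U U C \<beta>" "bilinear_map U U C \<gamma>"
    and "\<And>a b. a \<in> carrier U \<Longrightarrow> b \<in> carrier U \<Longrightarrow> \<beta> a b = \<gamma> a b" and "X \<in> carrier U"
  shows "sweedler C \<beta> X = sweedler C \<gamma> X"
  unfolding sweedler_def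
  by (rule UU.linear_maps_tensor_eqI[OF UU.tensor_lift_linear(1)[OF assms(1,2)] UU.tensor_lift_linear(1)[OF assms(1,3)]])
    (use assms in \<open>simp_all add: UU.tensor_lift_linear linear_mapsD[OF coproduct_linear]\<close>)

lemma sweedler_add:
  assumes "linear_space C" "bilinear_map U U C \<beta>" "bilinear_map U U C \<gamma>" "X \<in> carrier U"
  shows "sweedler C (\<lambda>a b. \<beta> a b \<oplus>\<^bsub>C\<^esub> \<gamma> a b) X = sweedler C \<beta> X \<oplus>\<^bsub>C\<^esub> sweedler C \<gamma> X"
proof -
  interpret C: linear_space C by fact
  note bil = C.bilinear_map_add[OF assms(2,3)]
  show ?thesis
    unfolding sweedler_def
    by (rule UU.linear_maps_tensor_eqI[OF UU.tensor_lift_linear(1)[OF assms(1) bil]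
          C.linear_maps_add[OF UU.tensor_lift_linear(1)[OF assms(1,2)] UU.tensor_lift_linear(1)[OF assms(1,3)]]])
      (use assms bil in \<open>simp_all add: UU.tensor_lift_linear linear_mapsD[OF coproduct_linear]\<close>)
qed

lemma sweedler_comp:
  assumes "linear_space C" "linear_space C'" "bilinear_map U U C \<beta>" "h \<in> linear_maps C C'" "X \<in> carrier U"
  shows "h (sweedler C \<beta> X) = sweedler C' (\<lambda>a b. h (\<beta> a b)) X"
proof -
  note bil = bilinear_map_comp_left[OF assms(3,4)]
  show ?thesis
    unfolding sweedler_def
    by (rule UU.linear_maps_tensor_eqI[OF linear_maps_comp[OF assms(4) UU.tensor_lift_linear(1)[OF assms(1,3)]]
          UU.tensor_lift_linear(1)[OF assms(2) bil]])
      (use assms bil in \<open>simp_all add: UU.tensor_lift_linear linear_mapsD[OF coproduct_linear]\<close>)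
qed

end

section \<open>The antipode\<close>

lemma (in unital_algebra) unital_algebra_opp: "unital_algebra (opp_algebra A)"
proof -
  let ?B = "opp_algebra A"
  have sel: "carrier ?B = carrier A" "\<zero>\<^bsub>?B\<^esub> = \<zero>" "\<one>\<^bsub>?B\<^esub> = \<one>" "a \<oplus>\<^bsub>?B\<^esub> b = a \<oplus> b"
    "a \<otimes>\<^bsub>?B\<^esub> b = b \<otimes> a" "c \<odot>\<^bsub>?B\<^esub> a = c \<odot> a" for a b c
    by (simp_all add: opp_algebra_def)
  have "abelian_group ?B"
  proof (rule abelian_groupI)
    fix x assume "x \<in> carrier ?B"
    then show "\<exists>y\<in>carrier ?B. y \<oplus>\<^bsub>?B\<^esub> x = \<zero>\<^bsub>?B\<^esub>"
      by (intro bexI[of _ "\<ominus> x"]) (auto simp: sel l_neg)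
  qed (auto simp: sel a_ac)
  moreover have "ring ?B"
    by (rule ringI, fact, rule monoidI) (auto simp: sel m_assoc l_distr r_distr)
  moreover have "linear_space_axioms ?B"
    by (rule linear_space_axioms.intro) (auto simp: sel smult_l_distr smult_r_distr smult_smult)
  moreover have "unital_algebra_axioms ?B"
    by (rule unital_algebra_axioms.intro) (auto simp: sel smult_mult_left smult_mult_right)
  ultimately show ?thesis
    by (intro unital_algebra.intro linear_space.intro)
qed

text \<open>
  The assignment \<open>x \<mapsto> - x\<close> respects brackets for the opposite product, since the two signs cancel
  and the order of the factors is reversed.
\<close>

lemma (in enveloping) antipode_hom:
  shows antipode_linear: "uea_antipode scale bracket \<in> linear_maps U U"
    and antipode_one: "uea_antipode scale bracket \<one>\<^bsub>U\<^esub> = \<one>\<^bsub>U\<^esub>"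
    and antipode_gen: "uea_antipode scale bracket (\<iota> x) = \<iota> (- x)"
    and antipode_mult: "X \<in> carrier U \<Longrightarrow> Y \<in> carrier U \<Longrightarrow>
      uea_antipode scale bracket (X \<otimes>\<^bsub>U\<^esub> Y) = uea_antipode scale bracket Y \<otimes>\<^bsub>U\<^esub> uea_antipode scale bracket X"
proof -
  let ?B = "opp_algebra U"
  have sel: "carrier ?B = carrier U" "\<one>\<^bsub>?B\<^esub> = \<one>\<^bsub>U\<^esub>" "a \<oplus>\<^bsub>?B\<^esub> b = a \<oplus>\<^bsub>U\<^esub> b"
    "a \<otimes>\<^bsub>?B\<^esub> b = b \<otimes>\<^bsub>U\<^esub> a" "c \<odot>\<^bsub>?B\<^esub> a = c \<odot>\<^bsub>U\<^esub> a" for a b c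
    by (simp_all add: opp_algebra_def)
  have lin: "linear_maps U ?B = linear_maps U U" by (simp add: linear_maps_def sel)
  have add: "\<iota> (- (x + y)) = \<iota> (- x) \<oplus>\<^bsub>?B\<^esub> \<iota> (- y)" for x y
    by (simp only: gen_uminus gen_add sel) (simp add: minus_add)
  have scale: "\<iota> (- scale c x) = c \<odot>\<^bsub>?B\<^esub> \<iota> (- x)" for c x
    using smult_smult[of "\<iota> x" c "- 1"] smult_smult[of "\<iota> x" "- 1" c] smult_minus_left[of "\<iota> x" 1] smult_minus_left[of "c \<odot>\<^bsub>U\<^esub> \<iota> x" 1]
    by (simp add: gen_uminus gen_scale sel)
  have bracket: "\<iota> (- x) \<otimes>\<^bsub>?B\<^esub> \<iota> (- y) = \<iota> (- y) \<otimes>\<^bsub>?B\<^esub> \<iota> (- x) \<oplus>\<^bsub>?B\<^esub> \<iota> (- bracket x y)" for x y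
    by (simp add: sel gen_uminus l_minus r_minus gen_bracket[of x y] a_assoc r_neg)
  note hom = uea_lift_hom[where f = "\<lambda>x. \<iota> (- x)", OF unital_algebra_opp _ add scale bracket,
      folded uea_antipode_def, unfolded sel lin]
  show "uea_antipode scale bracket \<in> linear_maps U U" by (rule hom(1)) simp
  show "uea_antipode scale bracket \<one>\<^bsub>U\<^esub> = \<one>\<^bsub>U\<^esub>" by (rule hom(2)) simp
  show "uea_antipode scale bracket (\<iota> x) = \<iota> (- x)" by (rule hom(3)) simp
  show "uea_antipode scale bracket (X \<otimes>\<^bsub>U\<^esub> Y) = uea_antipode scale bracket Y \<otimes>\<^bsub>U\<^esub> uea_antipode scale bracket X"
    if "X \<in> carrier U" "Y \<in> carrier U" by (rule hom(4)) (simp_all add: that)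
qed

section \<open>The extended post-Lie product and the Grossman-Larson product\<close>

locale rota_baxter = enveloping scale bracket
  for scale :: "'k::field \<Rightarrow> 'g::ab_group_add \<Rightarrow> 'g" and bracket :: "'g \<Rightarrow> 'g \<Rightarrow> 'g" +
  fixes \<pi> :: "'g \<Rightarrow> 'g"
    and tri :: "('g list \<Rightarrow>\<^sub>0 'k) set \<Rightarrow> ('g list \<Rightarrow>\<^sub>0 'k) set \<Rightarrow> ('g list \<Rightarrow>\<^sub>0 'k) set"
  assumes lie_algebra: "lie_algebra scale bracket"
    and linear_\<pi>: "Vector_Spaces.linear scale scale \<pi>"
    and rota_baxter: "bracket (\<pi> x) (\<pi> y) + \<pi> (bracket x y) = \<pi> (bracket (\<pi> x) y + bracket x (\<pi> y))"
    and extension: "post_lie_extension scale bracket (post_lie_product bracket \<pi>) tri"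
begin

abbreviation "star \<equiv> star_product scale bracket tri"

lemma tri_bilinear: "bilinear_map U U U tri"
  and tri_gen: "tri (\<iota> x) (\<iota> y) = \<iota> (- bracket (\<pi> x) y)"
  and tri_one: "X \<in> carrier U \<Longrightarrow> tri \<one>\<^bsub>U\<^esub> X = X"
  and tri_mult: "X \<in> carrier U \<Longrightarrow> Y \<in> carrier U \<Longrightarrow> Z \<in> carrier U \<Longrightarrow>
    tri X (Y \<otimes>\<^bsub>U\<^esub> Z) = sweedler U (\<lambda>X1 X2. tri X1 Y \<otimes>\<^bsub>U\<^esub> tri X2 Z) X"
  and tri_gen_mult: "X \<in> carrier U \<Longrightarrow> Y \<in> carrier U \<Longrightarrow>
    tri (\<iota> x \<otimes>\<^bsub>U\<^esub> X) Y = tri (\<iota> x) (tri X Y) \<ominus>\<^bsub>U\<^esub> tri (tri (\<iota> x) X) Y"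
  using extension unfolding post_lie_extension_def Let_def sweedler_def post_lie_product_def by blast+

lemmas tri_linear = bilinear_mapD[OF tri_bilinear]

lemma tri_closed [simp]: "X \<in> carrier U \<Longrightarrow> Y \<in> carrier U \<Longrightarrow> tri X Y \<in> carrier U"
  by (rule linear_mapsD(1)[OF tri_linear(2)])

lemma tri_derivation:
  assumes "Y \<in> carrier U" "Z \<in> carrier U"
  shows "tri (\<iota> x) (Y \<otimes>\<^bsub>U\<^esub> Z) = tri (\<iota> x) Y \<otimes>\<^bsub>U\<^esub> Z \<oplus>\<^bsub>U\<^esub> Y \<otimes>\<^bsub>U\<^esub> tri (\<iota> x) Z"
proof -
  have "bilinear_map U U U (\<lambda>X1 X2. tri X1 Y \<otimes>\<^bsub>U\<^esub> tri X2 Z)"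
    by (intro bilinear_map_comp[OF bilinear_map_mult] tri_linear(1) assms)
  then show ?thesis
    using assms by (simp add: tri_mult sweedler_gen[OF linear_space_axioms] tri_one)
qed

text \<open>
  A derivation kills the unit.
\<close>

lemma tri_gen_unit: "tri (\<iota> x) \<one>\<^bsub>U\<^esub> = \<zero>\<^bsub>U\<^esub>"
proof -
  have "tri (\<iota> x) \<one>\<^bsub>U\<^esub> = tri (\<iota> x) \<one>\<^bsub>U\<^esub> \<oplus>\<^bsub>U\<^esub> tri (\<iota> x) \<one>\<^bsub>U\<^esub>"
    using tri_derivation[of "\<one>\<^bsub>U\<^esub>" "\<one>\<^bsub>U\<^esub>" x] by simp
  then show ?thesis by (metis add.r_cancel_one' gen_closed one_closed tri_closed)
qed

text \<open>
  The maps \<open>x \<triangleright> _\<close> and \<open>- [\<pi> x, _]\<close> are derivations of the enveloping algebra that agree on the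
  generators.
\<close>

lemma tri_gen_eq_commutator:
  assumes "X \<in> carrier U"
  shows "\<iota> (\<pi> x) \<otimes>\<^bsub>U\<^esub> X \<oplus>\<^bsub>U\<^esub> tri (\<iota> x) X = X \<otimes>\<^bsub>U\<^esub> \<iota> (\<pi> x)"
  using assms
proof (induction rule: uea_induct)
  case one
  show ?case by (simp add: tri_gen_unit)
next
  case (gen z X)
  let ?p = "\<iota> (\<pi> x)"
  have "?p \<otimes>\<^bsub>U\<^esub> (\<iota> z \<otimes>\<^bsub>U\<^esub> X) \<oplus>\<^bsub>U\<^esub> tri (\<iota> x) (\<iota> z \<otimes>\<^bsub>U\<^esub> X)
      = (?p \<otimes>\<^bsub>U\<^esub> \<iota> z \<oplus>\<^bsub>U\<^esub> \<iota> (- bracket (\<pi> x) z)) \<otimes>\<^bsub>U\<^esub> X \<oplus>\<^bsub>U\<^esub> \<iota> z \<otimes>\<^bsub>U\<^esub> tri (\<iota> x) X"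
    using gen.hyps by (simp add: tri_derivation tri_gen l_distr m_assoc a_assoc)
  also have "?p \<otimes>\<^bsub>U\<^esub> \<iota> z \<oplus>\<^bsub>U\<^esub> \<iota> (- bracket (\<pi> x) z) = \<iota> z \<otimes>\<^bsub>U\<^esub> ?p"
    by (simp add: gen_bracket[of "\<pi> x" z] gen_uminus a_assoc r_neg)
  also have "\<iota> z \<otimes>\<^bsub>U\<^esub> ?p \<otimes>\<^bsub>U\<^esub> X \<oplus>\<^bsub>U\<^esub> \<iota> z \<otimes>\<^bsub>U\<^esub> tri (\<iota> x) X = \<iota> z \<otimes>\<^bsub>U\<^esub> (?p \<otimes>\<^bsub>U\<^esub> X \<oplus>\<^bsub>U\<^esub> tri (\<iota> x) X)"
    using gen.hyps by (simp add: r_distr m_assoc)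
  finally show ?case using gen by (simp add: m_assoc)
next
  case (add X Y)
  let ?p = "\<iota> (\<pi> x)"
  have "?p \<otimes>\<^bsub>U\<^esub> (X \<oplus>\<^bsub>U\<^esub> Y) \<oplus>\<^bsub>U\<^esub> tri (\<iota> x) (X \<oplus>\<^bsub>U\<^esub> Y)
      = (?p \<otimes>\<^bsub>U\<^esub> X \<oplus>\<^bsub>U\<^esub> tri (\<iota> x) X) \<oplus>\<^bsub>U\<^esub> (?p \<otimes>\<^bsub>U\<^esub> Y \<oplus>\<^bsub>U\<^esub> tri (\<iota> x) Y)"
    using add.hyps by (simp add: r_distr linear_mapsD(2)[OF tri_linear(2)] a_ac)
  then show ?case using add by (simp add: l_distr)
next
  case (smult c X)
  have "\<iota> (\<pi> x) \<otimes>\<^bsub>U\<^esub> (c \<odot>\<^bsub>U\<^esub> X) \<oplus>\<^bsub>U\<^esub> tri (\<iota> x) (c \<odot>\<^bsub>U\<^esub> X)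
      = c \<odot>\<^bsub>U\<^esub> (\<iota> (\<pi> x) \<otimes>\<^bsub>U\<^esub> X \<oplus>\<^bsub>U\<^esub> tri (\<iota> x) X)"
    using smult.hyps by (simp add: smult_mult_right linear_mapsD(3)[OF tri_linear(2)] smult_r_distr)
  then show ?case using smult by (simp add: smult_mult_left)
qed

lemma star_bilinear_arg:
  assumes "Y \<in> carrier U"
  shows "bilinear_map U U U (\<lambda>X1 X2. X1 \<otimes>\<^bsub>U\<^esub> tri X2 Y)"
  by (intro bilinear_map_comp[OF bilinear_map_mult] linear_maps_id tri_linear(1) assms)

lemma star_eq_sweedler: "star X Y = sweedler U (\<lambda>X1 X2. X1 \<otimes>\<^bsub>U\<^esub> tri X2 Y) X"
  by (simp add: star_product_def sweedler_def Let_def)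

lemma star_linear:
  assumes "Y \<in> carrier U"
  shows "(\<lambda>X. star X Y) \<in> linear_maps U U"
  unfolding star_eq_sweedler
  using sweedler_linear[OF linear_space_axioms star_bilinear_arg[OF assms]] .

lemma star_closed [simp]: "X \<in> carrier U \<Longrightarrow> Y \<in> carrier U \<Longrightarrow> star X Y \<in> carrier U"
  by (rule linear_mapsD(1)[OF star_linear])

lemma star_one: "Y \<in> carrier U \<Longrightarrow> star \<one>\<^bsub>U\<^esub> Y = Y"
  by (simp add: star_eq_sweedler sweedler_one[OF linear_space_axioms star_bilinear_arg] tri_one)

lemma gen_split: "\<iota> x = \<iota> (x - \<pi> x) \<oplus>\<^bsub>U\<^esub> \<iota> (\<pi> x)"
  by (simp flip: gen_add)

text \<open>
  The second formula is the reason for the shape of \<open>F\<close>: multiplication by a generator in the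
  product \<open>*\<close> splits into a multiplication by \<open>r_- x\<close> on the left and by \<open>- r_+ x\<close> on the right.
\<close>

lemma star_gen:
  assumes "Y \<in> carrier U"
  shows "star (\<iota> x) Y = \<iota> x \<otimes>\<^bsub>U\<^esub> Y \<oplus>\<^bsub>U\<^esub> tri (\<iota> x) Y"
    and "star (\<iota> x) Y = \<iota> (x - \<pi> x) \<otimes>\<^bsub>U\<^esub> Y \<oplus>\<^bsub>U\<^esub> Y \<otimes>\<^bsub>U\<^esub> \<iota> (\<pi> x)"
proof -
  show *: "star (\<iota> x) Y = \<iota> x \<otimes>\<^bsub>U\<^esub> Y \<oplus>\<^bsub>U\<^esub> tri (\<iota> x) Y"
    using assms by (simp add: star_eq_sweedler sweedler_gen[OF linear_space_axioms star_bilinear_arg] tri_one)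
  also have "\<dots> = \<iota> (x - \<pi> x) \<otimes>\<^bsub>U\<^esub> Y \<oplus>\<^bsub>U\<^esub> (\<iota> (\<pi> x) \<otimes>\<^bsub>U\<^esub> Y \<oplus>\<^bsub>U\<^esub> tri (\<iota> x) Y)"
    using assms by (subst gen_split[of x]) (simp add: l_distr a_assoc)
  finally show "star (\<iota> x) Y = \<iota> (x - \<pi> x) \<otimes>\<^bsub>U\<^esub> Y \<oplus>\<^bsub>U\<^esub> Y \<otimes>\<^bsub>U\<^esub> \<iota> (\<pi> x)"
    by (simp add: tri_gen_eq_commutator assms)
qed

text \<open>
  This is the defining rule \<open>(x X) \<triangleright> Y = x \<triangleright> (X \<triangleright> Y) - (x \<triangleright> X) \<triangleright> Y\<close>, read as the statement that
  \<open>\<triangleright>\<close> is an action for the product \<open>*\<close>.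
\<close>

lemma tri_star_gen:
  assumes "X \<in> carrier U" "Y \<in> carrier U"
  shows "tri (star (\<iota> x) X) Y = tri (\<iota> x) (tri X Y)"
  using assms
  by (simp add: star_gen(1) linear_mapsD(2)[OF tri_linear(1)] tri_gen_mult minus_eq a_assoc l_neg)

text \<open>
  With \<open>a = x - \<pi> x\<close> and \<open>b = \<pi> x\<close> the claim is
  \<open>(a X) * Y + (X b) * Y = a (X * Y) + (X * Y) b\<close>. Expanding the left side with the coproduct gives
  four terms. One of them is \<open>a (X * Y)\<close>; the other three combine, already before summation over the
  coproduct of \<open>X\<close>, because
  \<open>(a X\<^sub>(\<^sub>2\<^sub>) + X\<^sub>(\<^sub>2\<^sub>) b) \<triangleright> Y + b (X\<^sub>(\<^sub>2\<^sub>) \<triangleright> Y) = x \<triangleright> (X\<^sub>(\<^sub>2\<^sub>) \<triangleright> Y) + b (X\<^sub>(\<^sub>2\<^sub>) \<triangleright> Y) = (X\<^sub>(\<^sub>2\<^sub>) \<triangleright> Y) b\<close>.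
\<close>

lemma star_assoc_gen:
  assumes X: "X \<in> carrier U" and Y: "Y \<in> carrier U"
  shows "star (star (\<iota> x) X) Y = star (\<iota> x) (star X Y)"
proof -
  let ?a = "\<iota> (x - \<pi> x)" and ?b = "\<iota> (\<pi> x)"
  note sp = linear_space_axioms
  note bil = star_bilinear_arg[OF Y]
  note bila = bilinear_map_mult_args[OF bil gen_closed[of "x - \<pi> x"]]
  note bilb = bilinear_map_mult_args[OF bil gen_closed[of "\<pi> x"]]
  have lmult: "(\<lambda>Z. ?a \<otimes>\<^bsub>U\<^esub> Z) \<in> linear_maps U U" and rmult: "(\<lambda>Z. Z \<otimes>\<^bsub>U\<^esub> ?b) \<in> linear_maps U U"
    using bilinear_mapD[OF bilinear_map_mult] by auto
  note bil_r = bilinear_map_comp_left[OF bil rmult]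
  have left: "sweedler U (\<lambda>X1 X2. ?a \<otimes>\<^bsub>U\<^esub> X1 \<otimes>\<^bsub>U\<^esub> tri X2 Y) X = ?a \<otimes>\<^bsub>U\<^esub> star X Y"
    unfolding star_eq_sweedler sweedler_comp[OF sp sp bil lmult X]
    by (rule sweedler_cong[OF sp bila(1) bilinear_map_comp_left[OF bil lmult] _ X]) (simp add: m_assoc Y)
  have pointwise: "X1 \<otimes>\<^bsub>U\<^esub> tri (?a \<otimes>\<^bsub>U\<^esub> X2) Y \<oplus>\<^bsub>U\<^esub> (X1 \<otimes>\<^bsub>U\<^esub> ?b \<otimes>\<^bsub>U\<^esub> tri X2 Y \<oplus>\<^bsub>U\<^esub> X1 \<otimes>\<^bsub>U\<^esub> tri (X2 \<otimes>\<^bsub>U\<^esub> ?b) Y)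
      = X1 \<otimes>\<^bsub>U\<^esub> tri X2 Y \<otimes>\<^bsub>U\<^esub> ?b"
    if c: "X1 \<in> carrier U" "X2 \<in> carrier U" for X1 X2
  proof -
    have "X1 \<otimes>\<^bsub>U\<^esub> tri (?a \<otimes>\<^bsub>U\<^esub> X2) Y \<oplus>\<^bsub>U\<^esub> (X1 \<otimes>\<^bsub>U\<^esub> ?b \<otimes>\<^bsub>U\<^esub> tri X2 Y \<oplus>\<^bsub>U\<^esub> X1 \<otimes>\<^bsub>U\<^esub> tri (X2 \<otimes>\<^bsub>U\<^esub> ?b) Y)
        = X1 \<otimes>\<^bsub>U\<^esub> (?b \<otimes>\<^bsub>U\<^esub> tri X2 Y \<oplus>\<^bsub>U\<^esub> tri (?a \<otimes>\<^bsub>U\<^esub> X2 \<oplus>\<^bsub>U\<^esub> X2 \<otimes>\<^bsub>U\<^esub> ?b) Y)"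
      using c Y by (simp add: linear_mapsD(2)[OF tri_linear(1)] r_distr m_assoc a_ac)
    also have "tri (?a \<otimes>\<^bsub>U\<^esub> X2 \<oplus>\<^bsub>U\<^esub> X2 \<otimes>\<^bsub>U\<^esub> ?b) Y = tri (\<iota> x) (tri X2 Y)"
      using tri_star_gen[OF c(2) Y, of x] by (simp add: star_gen(2) c)
    finally show ?thesis using c Y by (simp add: tri_gen_eq_commutator m_assoc)
  qed
  have right: "sweedler U (\<lambda>X1 X2. X1 \<otimes>\<^bsub>U\<^esub> tri (?a \<otimes>\<^bsub>U\<^esub> X2) Y) X \<oplus>\<^bsub>U\<^esub>
      (sweedler U (\<lambda>X1 X2. X1 \<otimes>\<^bsub>U\<^esub> ?b \<otimes>\<^bsub>U\<^esub> tri X2 Y) X \<oplus>\<^bsub>U\<^esub> sweedler U (\<lambda>X1 X2. X1 \<otimes>\<^bsub>U\<^esub> tri (X2 \<otimes>\<^bsub>U\<^esub> ?b) Y) X)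
      = star X Y \<otimes>\<^bsub>U\<^esub> ?b"
    unfolding star_eq_sweedler sweedler_comp[OF sp sp bil rmult X]
      sweedler_add[OF sp bilb(3,4) X, symmetric]
      sweedler_add[OF sp bila(2) bilinear_map_add[OF bilb(3,4)] X, symmetric]
    by (rule sweedler_cong[OF sp bilinear_map_add[OF bila(2) bilinear_map_add[OF bilb(3,4)]] bil_r pointwise X])
  have closed: "sweedler U \<beta> X \<in> carrier U" if "bilinear_map U U U \<beta>" for \<beta>
    using linear_mapsD(1)[OF sweedler_linear[OF sp that]] X .
  have "star (star (\<iota> x) X) Y = star (?a \<otimes>\<^bsub>U\<^esub> X) Y \<oplus>\<^bsub>U\<^esub> star (X \<otimes>\<^bsub>U\<^esub> ?b) Y"
    using X by (simp add: star_gen(2) linear_mapsD(2)[OF star_linear[OF Y]])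
  also have "\<dots> = ?a \<otimes>\<^bsub>U\<^esub> star X Y \<oplus>\<^bsub>U\<^esub> star X Y \<otimes>\<^bsub>U\<^esub> ?b"
    unfolding star_eq_sweedler[of "?a \<otimes>\<^bsub>U\<^esub> X"] star_eq_sweedler[of "X \<otimes>\<^bsub>U\<^esub> ?b"]
      sweedler_gen_mult[OF sp bil X] left right[symmetric]
    using X Y by (simp add: closed bila bilb a_assoc)
  finally show ?thesis using X Y by (simp add: star_gen(2))
qed

section \<open>The map F\<close>

sublocale D: enveloping scale "double_bracket bracket \<pi>" .

lemma \<pi>_add: "\<pi> (x + y) = \<pi> x + \<pi> y" and \<pi>_scale: "\<pi> (scale c x) = scale c (\<pi> x)"
  using linear_\<pi> by (simp_all add: Vector_Spaces.linear_iff)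

lemma \<pi>_diff: "\<pi> (x - y) = \<pi> x - \<pi> y"
  using \<pi>_add[of "x - y" y] by (simp add: algebra_simps)

lemma bracket_uminus:
  "bracket (- x) y = - bracket x y" "bracket x (- y) = - bracket x y"
  and bracket_diff:
  "bracket (x - y) z = bracket x z - bracket y z" "bracket x (y - z) = bracket x y - bracket x z"
proof -
  interpret lie_algebra scale bracket by (rule lie_algebra)
  interpret l: Vector_Spaces.linear scale scale "\<lambda>x. bracket x w" for w by (rule bracket_linear_left)
  interpret r: Vector_Spaces.linear scale scale "bracket w" for w by (rule bracket_linear_right)
  show "bracket (- x) y = - bracket x y" "bracket x (- y) = - bracket x y"
    "bracket (x - y) z = bracket x z - bracket y z" "bracket x (y - z) = bracket x y - bracket x z"
    by (rule l.neg r.neg l.diff r.diff)+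
qed

text \<open>
  Both \<open>r_+\<close> and \<open>r_-\<close> are Lie algebra morphisms out of the double Lie algebra; in either case this is
  the Rota-Baxter identity after expansion.
\<close>

lemma r_plus_bracket: "r_plus \<pi> (double_bracket bracket \<pi> x y) = bracket (r_plus \<pi> x) (r_plus \<pi> y)"
  and r_minus_bracket: "r_minus \<pi> (double_bracket bracket \<pi> x y) = bracket (r_minus \<pi> x) (r_minus \<pi> y)"
  using rota_baxter[of x y]
  by (simp_all add: r_plus_def r_minus_def compl_proj_def double_bracket_def bracket_uminus bracket_diff
      \<pi>_add \<pi>_diff algebra_simps)

lemma scale_diff: "scale c (x - y) = scale c x - scale c y" and scale_uminus: "scale c (- x) = - scale c x"
proof -
  interpret lie_algebra scale bracket by (rule lie_algebra)
  show "scale c (x - y) = scale c x - scale c y" "scale c (- x) = - scale c x"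
    by (simp_all add: scale_right_diff_distrib)
qed

lemma uea_map_hom:
  assumes add: "\<And>x y. f (x + y) = f x + f y" and scale: "\<And>c x. f (scale c x) = scale c (f x)"
    and bracket: "\<And>x y. f (double_bracket bracket \<pi> x y) = bracket (f x) (f y)"
  shows "uea_map scale bracket f \<in> linear_maps D.U U"
    and "uea_map scale bracket f \<one>\<^bsub>D.U\<^esub> = \<one>\<^bsub>U\<^esub>"
    and "X \<in> carrier D.U \<Longrightarrow> uea_map scale bracket f (D.\<iota> x \<otimes>\<^bsub>D.U\<^esub> X) = \<iota> (f x) \<otimes>\<^bsub>U\<^esub> uea_map scale bracket f X"
proof -
  note hom = D.uea_lift_hom[where f = "\<lambda>x. \<iota> (f x)", OF unital_algebra_axioms, folded uea_map_def]
  have "\<iota> (f (x + y)) = \<iota> (f x) \<oplus>\<^bsub>U\<^esub> \<iota> (f y)" "\<iota> (f (scale c x)) = c \<odot>\<^bsub>U\<^esub> \<iota> (f x)"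
    "\<iota> (f x) \<otimes>\<^bsub>U\<^esub> \<iota> (f y) = \<iota> (f y) \<otimes>\<^bsub>U\<^esub> \<iota> (f x) \<oplus>\<^bsub>U\<^esub> \<iota> (f (double_bracket bracket \<pi> x y))" for c x y
    by (simp_all add: add scale bracket gen_add gen_scale gen_bracket[of "f x"])
  note hom = hom[OF gen_closed this]
  show "uea_map scale bracket f \<in> linear_maps D.U U" "uea_map scale bracket f \<one>\<^bsub>D.U\<^esub> = \<one>\<^bsub>U\<^esub>"
    by (rule hom)+
  show "uea_map scale bracket f (D.\<iota> x \<otimes>\<^bsub>D.U\<^esub> X) = \<iota> (f x) \<otimes>\<^bsub>U\<^esub> uea_map scale bracket f X"
    if "X \<in> carrier D.U"
    using hom(4)[OF D.gen_closed that] by (simp add: hom(3))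
qed

lemma r_minus_linear: "r_minus \<pi> (x + y) = r_minus \<pi> x + r_minus \<pi> y" "r_minus \<pi> (scale c x) = scale c (r_minus \<pi> x)"
  and r_plus_linear: "r_plus \<pi> (x + y) = r_plus \<pi> x + r_plus \<pi> y" "r_plus \<pi> (scale c x) = scale c (r_plus \<pi> x)"
  by (simp_all add: r_minus_def r_plus_def compl_proj_def \<pi>_add \<pi>_scale scale_diff scale_uminus)

abbreviation "R_minus \<equiv> uea_map scale bracket (r_minus \<pi>)"
abbreviation "R_plus \<equiv> uea_map scale bracket (r_plus \<pi>)"
abbreviation "antipode \<equiv> uea_antipode scale bracket"
abbreviation "F \<equiv> F_map scale bracket \<pi>"

lemmas R_minus_hom = uea_map_hom[OF r_minus_linear r_minus_bracket]
lemmas R_plus_hom = uea_map_hom[OF r_plus_linear r_plus_bracket]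

lemma F_bilinear: "bilinear_map D.U D.U U (\<lambda>X1 X2. R_minus X1 \<otimes>\<^bsub>U\<^esub> antipode (R_plus X2))"
  by (rule bilinear_map_comp[OF bilinear_map_mult R_minus_hom(1) linear_maps_comp[OF antipode_linear R_plus_hom(1)]])

text \<open>
  The composite of the maps in the definition of \<open>F\<close> and the map on the right are linear on the
  tensor square, and they agree on pure tensors.
\<close>

lemma F_eq_sweedler:
  assumes "X \<in> carrier D.U"
  shows "F X = D.sweedler U (\<lambda>X1 X2. R_minus X1 \<otimes>\<^bsub>U\<^esub> antipode (R_plus X2)) X"
proof -
  have rr: "bilinear_map D.U D.U UU.T (\<lambda>X1 X2. pure (R_minus X1) (R_plus X2))"
    by (rule bilinear_map_comp[OF UU.bilinear_map_pure_tensor R_minus_hom(1) R_plus_hom(1)])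
  have ia: "bilinear_map U U UU.T (\<lambda>X1 X2. pure X1 (antipode X2))"
    by (rule bilinear_map_comp[OF UU.bilinear_map_pure_tensor linear_maps_id antipode_linear])
  note l1 = D.UU.tensor_lift_linear[OF UU.T.linear_space_axioms rr, folded tensor_map_def]
  have t2: "tensor_lift UU.T (\<lambda>X1 X2. pure X1 (antipode X2)) = tensor_map U U id antipode"
    by (simp add: tensor_map_def)
  note l2 = UU.tensor_lift_linear[OF UU.T.linear_space_axioms ia, unfolded t2]
  note l3 = UU.tensor_lift_linear[OF linear_space_axioms bilinear_map_mult]
  note lF = D.UU.tensor_lift_linear[OF linear_space_axioms F_bilinear]
  have "tensor_lift U (\<otimes>\<^bsub>U\<^esub>) (tensor_map U U id antipode (tensor_map U U R_minus R_plus t))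
      = tensor_lift U (\<lambda>X1 X2. R_minus X1 \<otimes>\<^bsub>U\<^esub> antipode (R_plus X2)) t" if "t \<in> carrier D.UU.T" for t
    by (rule D.UU.linear_maps_tensor_eqI[OF linear_maps_comp[OF l3(1) linear_maps_comp[OF l2(1) l1(1)]] lF(1) _ that])
      (simp add: l1(2) l2(2) l3(2) lF(2) linear_mapsD(1)[OF R_minus_hom(1)] linear_mapsD(1)[OF R_plus_hom(1)]
        linear_mapsD(1)[OF antipode_linear])
  then show ?thesis
    using linear_mapsD(1)[OF D.coproduct_linear assms]
    by (simp add: F_map_def Let_def D.sweedler_def)
qed

lemma F_linear: "F \<in> linear_maps D.U U"
proof -
  note lin = linear_mapsD[OF D.sweedler_linear[OF linear_space_axioms F_bilinear]]
  show ?thesis by (rule linear_mapsI) (simp_all add: F_eq_sweedler lin)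
qed

lemma F_one: "F \<one>\<^bsub>D.U\<^esub> = \<one>\<^bsub>U\<^esub>"
  by (simp add: F_eq_sweedler D.sweedler_one[OF linear_space_axioms F_bilinear] R_minus_hom R_plus_hom antipode_one)

text \<open>
  The generator goes to the left tensor factor, where \<open>r_-\<close> turns it into a left factor \<open>x - \<pi> x\<close>, or
  to the right one, where the antipode reverses the order and turns it into a right factor \<open>\<pi> x\<close>.
  This is the formula for \<open>*\<close> in lemma \<open>star_gen\<close>.
\<close>

lemma F_gen_mult:
  assumes X: "X \<in> carrier D.U"
  shows "F (D.\<iota> x \<otimes>\<^bsub>D.U\<^esub> X) = star (\<iota> x) (F X)"
proof -
  let ?a = "\<iota> (x - \<pi> x)" and ?b = "\<iota> (\<pi> x)"
  let ?\<beta> = "\<lambda>X1 X2. R_minus X1 \<otimes>\<^bsub>U\<^esub> antipode (R_plus X2)"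
  note sp = linear_space_axioms
  have lmult: "(\<lambda>Z. ?a \<otimes>\<^bsub>U\<^esub> Z) \<in> linear_maps U U" and rmult: "(\<lambda>Z. Z \<otimes>\<^bsub>U\<^esub> ?b) \<in> linear_maps U U"
    using bilinear_mapD[OF bilinear_map_mult] by auto
  note bil = D.bilinear_map_mult_args[OF F_bilinear D.gen_closed[of x]]
  note closed = linear_mapsD(1)[OF R_minus_hom(1)] linear_mapsD(1)[OF R_plus_hom(1)] linear_mapsD(1)[OF antipode_linear]
  have left: "D.sweedler U (\<lambda>X1 X2. R_minus (D.\<iota> x \<otimes>\<^bsub>D.U\<^esub> X1) \<otimes>\<^bsub>U\<^esub> antipode (R_plus X2)) X
      = ?a \<otimes>\<^bsub>U\<^esub> D.sweedler U ?\<beta> X"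
    unfolding D.sweedler_comp[OF sp sp F_bilinear lmult X]
    by (rule D.sweedler_cong[OF sp bil(1) bilinear_map_comp_left[OF F_bilinear lmult] _ X])
      (simp add: R_minus_hom(3) closed m_assoc, simp add: r_minus_def compl_proj_def)
  have right: "D.sweedler U (\<lambda>X1 X2. R_minus X1 \<otimes>\<^bsub>U\<^esub> antipode (R_plus (D.\<iota> x \<otimes>\<^bsub>D.U\<^esub> X2))) X
      = D.sweedler U ?\<beta> X \<otimes>\<^bsub>U\<^esub> ?b"
    unfolding D.sweedler_comp[OF sp sp F_bilinear rmult X]
    by (rule D.sweedler_cong[OF sp bil(2) bilinear_map_comp_left[OF F_bilinear rmult] _ X])
      (simp add: R_plus_hom(3) antipode_mult antipode_gen closed m_assoc, simp add: r_plus_def)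
  have "F (D.\<iota> x \<otimes>\<^bsub>D.U\<^esub> X) = ?a \<otimes>\<^bsub>U\<^esub> F X \<oplus>\<^bsub>U\<^esub> F X \<otimes>\<^bsub>U\<^esub> ?b"
    using X by (simp add: F_eq_sweedler D.sweedler_gen_mult(1)[OF sp F_bilinear X] left right)
  then show ?thesis
    using X by (simp add: star_gen(2) linear_mapsD(1)[OF F_linear])
qed

lemma F_mult:
  assumes "X \<in> carrier D.U" and Y: "Y \<in> carrier D.U"
  shows "F (X \<otimes>\<^bsub>D.U\<^esub> Y) = star (F X) (F Y)"
proof -
  note lin = linear_mapsD[OF F_linear]
  note star_lin = linear_mapsD[OF star_linear[OF lin(1)[OF Y]]]
  show ?thesis
    using assms(1)
  proof (induction rule: D.uea_induct)
    case one
    show ?case using Y by (simp add: F_one star_one lin)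
  next
    case (gen x X)
    then show ?case using Y by (simp add: D.m_assoc F_gen_mult star_assoc_gen lin)
  next
    case (add X X')
    then show ?case using Y by (simp add: D.l_distr lin star_lin)
  next
    case (smult c X)
    then show ?case using Y by (simp add: D.smult_mult_left lin star_lin)
  qed
qed

end

theorem proposition4p10:
  fixes scale :: "'k::field_char_0 \<Rightarrow> 'g::ab_group_add \<Rightarrow> 'g"
    and bracket :: "'g \<Rightarrow> 'g \<Rightarrow> 'g"
    and \<pi> :: "'g \<Rightarrow> 'g"
    and tri :: "('g list \<Rightarrow>\<^sub>0 'k) set \<Rightarrow> ('g list \<Rightarrow>\<^sub>0 'k) set \<Rightarrow> ('g list \<Rightarrow>\<^sub>0 'k) set"
  assumes "lie_algebra scale bracket"
    and "Vector_Spaces.linear scale scale \<pi>"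
    and "\<And>x y. bracket (\<pi> x) (\<pi> y) + \<pi> (bracket x y) = \<pi> (bracket (\<pi> x) y + bracket x (\<pi> y))"
    and "post_lie_extension scale bracket (post_lie_product bracket \<pi>) tri"
  shows "F_map scale bracket \<pi>
      \<in> algebra_hom (uea scale (double_bracket bracket \<pi>)) (uea_star scale bracket tri)
    \<and> (\<forall>xs. F_map scale bracket \<pi>
          (list_prod (uea scale (double_bracket bracket \<pi>))
            (map (uea_gen scale (double_bracket bracket \<pi>)) xs))
        = list_prod (uea_star scale bracket tri)
            (map (\<lambda>x. F_map scale bracket \<pi> (uea_gen scale (double_bracket bracket \<pi>) x)) xs))"
proof -
  interpret rota_baxter scale bracket \<pi> tri
    using assms by (rule rota_baxter.intro)
  have star_sel: "carrier (uea_star scale bracket tri) = carrier U" "\<one>\<^bsub>uea_star scale bracket tri\<^esub> = \<one>\<^bsub>U\<^esub>"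
    "X \<oplus>\<^bsub>uea_star scale bracket tri\<^esub> Y = X \<oplus>\<^bsub>U\<^esub> Y" "X \<otimes>\<^bsub>uea_star scale bracket tri\<^esub> Y = star X Y"
    "c \<odot>\<^bsub>uea_star scale bracket tri\<^esub> X = c \<odot>\<^bsub>U\<^esub> X" for X Y c
    by (simp_all add: uea_star_def)
  have "F \<in> algebra_hom D.U (uea_star scale bracket tri)"
    by (auto simp: algebra_hom_def ring_hom_def star_sel F_mult F_one linear_mapsD[OF F_linear])
  moreover have "F (list_prod D.U (map D.\<iota> xs)) = list_prod (uea_star scale bracket tri) (map (\<lambda>x. F (D.\<iota> x)) xs)" for xs
  proof (induction xs)
    case Nil
    show ?case by (simp add: list_prod_simps F_one star_sel)
  next
    case (Cons x xs)
    have "list_prod D.U (map D.\<iota> xs) \<in> carrier D.U" by (rule D.list_prod_closed) auto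
    then show ?case using Cons by (simp add: list_prod_simps F_mult star_sel)
  qed
  ultimately show ?thesis by blast
qed

end
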